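(* Let $a,b\in\mathbb{N}$ and $\mathbf{c}=(c_1,c_2,\dots)$ with $c_j\in\mathbb{N}_0$, and for $n,k\in\mathbb{N}$ let $\hat p(n,k)=|\mathscr{P}^{\mathbf{c}}_{a,b}(an+(b-2)k,k)|$. Then \[ \hat p(n,k) =\frac1{an+(b-1)k+1}\binom{an+(b-1)k+1}{k}\frac{k!}{n!}\,B_{n,k}(1!c_1,2!c_2,\dots). \]
   Context: For $a,b\in\mathbb{N}$ and $\mathbf{c}=(c_1,c_2,\dots)$, $c_j\in\mathbb{N}_0$, the set $\mathscr{P}^{\mathbf{c}}_{a,b}(r,k)$ consists of the colored partitions of a fixed convex $(r+2)$-gon (with distinguishable vertices) made by $k-1$ noncrossing diagonals into $k$ polygons, each of which has a number of sides congruent to $b$ modulo $a$, where each part which is an $(aj+b)$-gon ($j\ge1$) is assigned one of $c_j$ colors; i.e. $|\mathscr{P}^{\mathbf{c}}_{a,b}(r,k)|$ is the sum over such dissections, with parts being $(aj_1+b)$-,...,$(aj_k+b)$-gons ($j_i\ge1$), of $c_{j_1}\cdots c_{j_k}$. $B_{n,k}(x_1,x_2,\dots)$ denotes the partial Bell polynomial \[B_{n,k}(x_1,x_2,\dots)=\sum \frac{n!}{i_1!\,i_2!\cdots}\prod_{j\ge1}\Big(\frac{x_j}{j!}\Big)^{i_j},\] the sum over all sequences $(i_1,i_2,\dots)$ of nonnegative integers with $\sum_j i_j=k$ and $\sum_j j\,i_j=n$.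
   Formalization: For a=b=1 the parts may be 2-gons, which genuine diagonals cannot produce (the formula then fails, e.g. n=3, k=2), so parallel copies of diagonals and sides enclosing 2-gons are allowed; in all other cases dissections are the usual ones. A negative r counts as no partitions. *)

theory Defs
  imports Complex_Main "HOL-Library.Multiset" "HOL-Library.FuncSet"
begin

section \<open>Dissections of a convex polygon\<close>

text \<open>
  The convex \<open>N\<close>-gon has the vertices \<open>0, \<dots>, N - 1\<close> in cyclic order, and a chord is a set of two
  vertices.

  Since \<open>a = b = 1\<close> is allowed, parts may be \<open>(aj + b)\<close>-gons with \<open>a + b = 2\<close>, that is, digons. A
  dissection is therefore a \<^emph>\<open>multiset\<close> of pairwise noncrossing chords: a digon lies between two
  parallel copies of a chord, or between a side of the polygon and a parallel copy of that side. If
  no part is a digon, then all chords are distinct and none of them is a side, so they form an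
  ordinary set of noncrossing diagonals (see \<open>no_digons_iff\<close> and
  \<open>colored_partitions_genuine_diagonals\<close> below).
\<close>

definition chords :: "nat \<Rightarrow> nat set set" where
  "chords N = {e. e \<subseteq> {..<N} \<and> card e = 2}"

definition noncrossing :: "nat set set \<Rightarrow> bool" where
  "noncrossing E \<longleftrightarrow>
     (\<forall>u v x y. {u, v} \<in> E \<longrightarrow> {x, y} \<in> E \<longrightarrow> \<not> (u < x \<and> x < v \<and> v < y))"

text \<open>As a multiset, so that the 2-gon has two (parallel) sides.\<close>

definition boundary :: "nat \<Rightarrow> nat set multiset" where
  "boundary N = image_mset (\<lambda>i. {i, Suc i mod N}) (mset_set {..<N})"

definition dissection :: "nat \<Rightarrow> nat \<Rightarrow> nat set multiset \<Rightarrow> bool" where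
  "dissection N m D \<longleftrightarrow> set_mset D \<subseteq> chords N \<and> noncrossing (set_mset D) \<and> size D = m"

text \<open>
  The sides of the convex polygon with vertex set \<open>S\<close>: the vertices \<open>u < v\<close> of \<open>S\<close> are neighbours
  iff no other vertex of \<open>S\<close> lies between them, or all of them do.
\<close>

definition polygon_sides :: "nat set \<Rightarrow> nat set set" where
  "polygon_sides S =
     {{u, v} |u v. u \<in> S \<and> v \<in> S \<and> u < v \<and> (S \<inter> {u<..<v} = {} \<or> S \<subseteq> {u..v})}"

text \<open>
  The parts of a dissection. A part with at least three sides is given by its vertex set \<open>S\<close>: its
  sides are chords of the dissection or sides of the big polygon, and no chord of the dissection
  cuts through it. If a chord or side \<open>e\<close> is present \<open>m\<close> times in total, its copies bound \<open>m - 1\<close>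
  digons, which are told apart by the second component \<open>i\<close>.
\<close>

definition parts :: "nat \<Rightarrow> nat set multiset \<Rightarrow> (nat set \<times> nat) set" where
  "parts N D =
     {(S, 0) |S. S \<subseteq> {..<N} \<and> 3 \<le> card S \<and>
        polygon_sides S \<subseteq> set_mset (D + boundary N) \<and>
        (\<forall>e\<in>#D. e \<subseteq> S \<longrightarrow> e \<in> polygon_sides S)} \<union>
     {(e, i) |e i. e \<in> chords N \<and> Suc i < count (D + boundary N) e}"

abbreviation num_sides :: "nat set \<times> nat \<Rightarrow> nat" where
  "num_sides P \<equiv> card (fst P)"

definition admissible_dissections :: "nat \<Rightarrow> nat \<Rightarrow> int \<Rightarrow> nat \<Rightarrow> nat set multiset set" where
  "admissible_dissections a b r k =
     {D. 0 \<le> r \<and> dissection (nat (r + 2)) (k - 1) D \<and>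
         (\<forall>P \<in> parts (nat (r + 2)) D. \<exists>j\<ge>1. num_sides P = a * j + b)}"

text \<open>
  The parameter \<open>r\<close> is an integer because \<open>an + (b - 2)k\<close> can be negative when \<open>b = 1\<close>; there is no
  \<open>(r + 2)\<close>-gon, hence no partition, in that case. An \<open>(aj + b)\<close>-gon takes its color from
  \<open>{0, \<dots>, c j - 1}\<close>.
\<close>

definition colored_partitions ::
    "nat \<Rightarrow> nat \<Rightarrow> (nat \<Rightarrow> nat) \<Rightarrow> int \<Rightarrow> nat
      \<Rightarrow> (nat set multiset \<times> (nat set \<times> nat \<Rightarrow> nat)) set" where
  "colored_partitions a b c r k =
     (SIGMA D : admissible_dissections a b r k.
        \<Pi>\<^sub>E P \<in> parts (nat (r + 2)) D. {..<c ((num_sides P - b) div a)})"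


section \<open>Partial Bell polynomials\<close>

text \<open>
  The condition that the sum of all \<open>j * i j\<close> equals \<open>n\<close> forces \<open>i j = 0\<close> for \<open>j > n\<close>, so sequences
  supported in \<open>{1..n}\<close> suffice.
\<close>

definition bell_indices :: "nat \<Rightarrow> nat \<Rightarrow> (nat \<Rightarrow> nat) set" where
  "bell_indices n k =
     {i. (\<forall>j. j \<notin> {1..n} \<longrightarrow> i j = 0) \<and> (\<Sum>j=1..n. i j) = k \<and> (\<Sum>j=1..n. j * i j) = n}"

definition partial_bell :: "nat \<Rightarrow> nat \<Rightarrow> (nat \<Rightarrow> real) \<Rightarrow> real" where
  "partial_bell n k x =
     (\<Sum>i\<in>bell_indices n k.
        fact n / (\<Prod>j=1..n. fact (i j)) * (\<Prod>j=1..n. (x j / fact j) ^ i j))"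


section \<open>Basic facts\<close>

lemma finite_chords [simp]: "finite (chords N)"
  unfolding chords_def by (rule finite_subset[of _ "Pow {..<N}"]) auto

lemma finite_dissections: "finite {D. dissection N m D}"
proof (rule finite_subset)
  show "{D. dissection N m D} \<subseteq> mset ` {xs. set xs \<subseteq> chords N \<and> length xs = m}"
  proof
    fix D assume "D \<in> {D. dissection N m D}"
    moreover obtain xs where "mset xs = D" using ex_mset by blast
    ultimately show "D \<in> mset ` {xs. set xs \<subseteq> chords N \<and> length xs = m}"
      by (auto simp: dissection_def)
  qed
  show "finite (mset ` {xs. set xs \<subseteq> chords N \<and> length xs = m})"
    by (intro finite_imageI finite_lists_length_eq) simp
qed

lemma finite_admissible_dissections: "finite (admissible_dissections a b r k)"
  by (rule finite_subset[OF _ finite_dissections[of "nat (r + 2)" "k - 1"]])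
     (auto simp: admissible_dissections_def)

lemma finite_parts: "finite (parts N D)"
proof (rule finite_subset)
  show "parts N D \<subseteq> Pow {..<N} \<times> {0} \<union> (SIGMA e : chords N. {..<count (D + boundary N) e})"
    by (auto simp: parts_def)
qed auto

lemma card_colored_partitions:
  "card (colored_partitions a b c r k) =
     (\<Sum>D\<in>admissible_dissections a b r k.
        \<Prod>P\<in>parts (nat (r + 2)) D. c ((num_sides P - b) div a))"
  by (simp add: colored_partitions_def card_SigmaI finite_admissible_dissections finite_parts
      finite_PiE card_PiE)

lemma finite_bell_indices: "finite (bell_indices n k)"
proof (rule finite_subset)
  show "bell_indices n k \<subseteq> {f. \<forall>j. (j \<in> {1..n} \<longrightarrow> f j \<in> {0..k}) \<and> (j \<notin> {1..n} \<longrightarrow> f j = 0)}"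
    by (auto simp: bell_indices_def intro!: member_le_sum)
  show "finite {f::nat \<Rightarrow> nat. \<forall>j. (j \<in> {1..n} \<longrightarrow> f j \<in> {0..k}) \<and> (j \<notin> {1..n} \<longrightarrow> f j = 0)}"
    by (rule finite_set_of_finite_funs) auto
qed

lemma boundary_subset_chords:
  assumes "2 \<le> N"
  shows "set_mset (boundary N) \<subseteq> chords N"
proof
  fix e assume "e \<in> set_mset (boundary N)"
  then obtain i where i: "i < N" "e = {i, Suc i mod N}" by (auto simp: boundary_def)
  have "i \<noteq> Suc i mod N" using i assms by (cases "Suc i = N") auto
  then show "e \<in> chords N" using i assms by (auto simp: chords_def)
qed

lemma count_boundary:
  assumes "3 \<le> N"
  shows "count (boundary N) e = (if e \<in># boundary N then 1 else 0)"
proof -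
  have "inj_on (\<lambda>i. {i, Suc i mod N}) {..<N}"
  proof (rule inj_onI)
    fix i j assume ij: "i \<in> {..<N}" "j \<in> {..<N}" "{i, Suc i mod N} = {j, Suc j mod N}"
    show "i = j"
    proof (rule ccontr)
      assume "i \<noteq> j"
      with ij have "i = Suc j mod N" "j = Suc i mod N" by (auto simp: doubleton_eq_iff)
      moreover have "Suc j mod N = (if Suc j = N then 0 else Suc j)"
          "Suc i mod N = (if Suc i = N then 0 else Suc i)" using ij(1,2) by simp_all
      ultimately have "i = (if Suc j = N then 0 else Suc j)" "j = (if Suc i = N then 0 else Suc i)"
        by (simp_all only:)
      with assms show False by presburger
    qed
  qed
  then have "boundary N = mset_set ((\<lambda>i. {i, Suc i mod N}) ` {..<N})"
    by (simp add: boundary_def image_mset_mset_set)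
  then show ?thesis by (simp add: count_mset_set')
qed

lemma no_digons_iff:
  assumes "3 \<le> N" and "set_mset D \<subseteq> chords N"
  shows "(\<forall>P\<in>parts N D. 3 \<le> num_sides P) \<longleftrightarrow>
     (\<forall>e. count D e \<le> 1) \<and> set_mset D \<inter> set_mset (boundary N) = {}"
proof -
  have "(\<forall>P\<in>parts N D. 3 \<le> num_sides P) \<longleftrightarrow> (\<forall>e\<in>chords N. count (D + boundary N) e \<le> 1)"
  proof
    assume L: "\<forall>P\<in>parts N D. 3 \<le> num_sides P"
    show "\<forall>e\<in>chords N. count (D + boundary N) e \<le> 1"
    proof (rule ballI, rule ccontr)
      fix e assume e: "e \<in> chords N" "\<not> count (D + boundary N) e \<le> 1"
      then have "(e, 0) \<in> parts N D" by (auto simp: parts_def)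
      with L e show False by (force simp: chords_def)
    qed
  next
    assume "\<forall>e\<in>chords N. count (D + boundary N) e \<le> 1"
    then show "\<forall>P\<in>parts N D. 3 \<le> num_sides P" by (force simp: parts_def)
  qed
  also have "\<dots> \<longleftrightarrow> (\<forall>e. count D e \<le> 1) \<and> set_mset D \<inter> set_mset (boundary N) = {}"
  proof
    assume L: "\<forall>e\<in>chords N. count (D + boundary N) e \<le> 1"
    have "count D e \<le> 1" for e
    proof (cases "e \<in># D")
      case True
      then have "count (D + boundary N) e \<le> 1" using L assms(2) by blast
      then show ?thesis by simp
    qed (simp add: not_in_iff)
    moreover have "e \<notin># boundary N" if "e \<in># D" for e
    proof
      assume "e \<in># boundary N"
      then have "count D e > 0" "count (boundary N) e > 0" using that by auto
      moreover have "count D e + count (boundary N) e \<le> 1" using L assms(2) that by force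
      ultimately show False by linarith
    qed
    ultimately show "(\<forall>e. count D e \<le> 1) \<and> set_mset D \<inter> set_mset (boundary N) = {}" by blast
  next
    assume R: "(\<forall>e. count D e \<le> 1) \<and> set_mset D \<inter> set_mset (boundary N) = {}"
    show "\<forall>e\<in>chords N. count (D + boundary N) e \<le> 1"
    proof
      fix e
      show "count (D + boundary N) e \<le> 1"
      proof (cases "e \<in># D")
        case True
        with R have "count (boundary N) e = 0" by (meson disjoint_iff not_in_iff)
        with R show ?thesis by simp
      next
        case False
        then show ?thesis using count_boundary[OF assms(1), of e] by (simp add: not_in_iff)
      qed
    qed
  qed
  finally show ?thesis .
qed

lemma colored_partitions_genuine_diagonals:
  assumes "3 \<le> a + b" and "1 \<le> r" and "(D, f) \<in> colored_partitions a b c r k"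
  shows "D = mset_set (set_mset D)"
    and "set_mset D \<subseteq> chords (nat (r + 2)) - set_mset (boundary (nat (r + 2)))"
proof -
  let ?N = "nat (r + 2)"
  have adm: "D \<in> admissible_dissections a b r k"
    using assms(3) by (auto simp: colored_partitions_def)
  then have D: "set_mset D \<subseteq> chords ?N"
    by (auto simp: admissible_dissections_def dissection_def)
  have "3 \<le> num_sides P" if "P \<in> parts ?N D" for P
  proof -
    obtain j where "1 \<le> j" "num_sides P = a * j + b"
      using adm \<open>P \<in> parts ?N D\<close> unfolding admissible_dissections_def by blast
    moreover from \<open>1 \<le> j\<close> have "a * 1 \<le> a * j" by (rule mult_le_mono2)
    ultimately show ?thesis using assms(1) by linarith
  qed
  then have *: "(\<forall>e. count D e \<le> 1) \<and> set_mset D \<inter> set_mset (boundary ?N) = {}"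
    using no_digons_iff[of ?N D] D assms(2) by auto
  show "D = mset_set (set_mset D)"
  proof (rule multiset_eqI)
    fix e
    show "count D e = count (mset_set (set_mset D)) e"
    proof (cases "e \<in># D")
      case True
      then have "0 < count D e" by simp
      moreover have "count D e \<le> 1" using * by blast
      ultimately have "count D e = 1" by linarith
      then show ?thesis using True by (simp add: count_mset_set')
    qed (simp add: not_in_iff)
  qed
  show "set_mset D \<subseteq> chords ?N - set_mset (boundary ?N)" using * D by blast
qed

end

theory Submission
  imports Defs "HOL-Computational_Algebra.Formal_Power_Series" "HOL-Library.Infinite_Set"
begin

text \<open>
  Mark one of the chords of a dissection and cut along it: a dissection of an \<open>N\<close>-gon with \<open>m\<close>
  chords, one of them marked, is a pair of dissections with \<open>m - 1\<close> chords altogether. Parallel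
  copies of the marked chord cause no trouble, since the choice of the marked copy tells how many of
  them lie on each side. Hence, if \<open>W(N, m)\<close> is the weighted number of dissections, then
  \<open>m W(N, m)\<close> is the sum of \<open>W(N\<^sub>1, i) W(N\<^sub>2, m - 1 - i)\<close> over all pairs of vertices of the polygon
  and all \<open>i < m\<close>, where \<open>N\<^sub>1 + N\<^sub>2 = N + 2\<close>. Together with \<open>W(N, 0)\<close> this determines \<open>W\<close>.

  The numbers \<open>q / (l + k) (l + k choose k) [x^(l + k - q)] F^k\<close> count plane forests with \<open>q\<close> trees,
  \<open>l\<close> leaves and \<open>k\<close> inner nodes, weighted by the coefficients of \<open>F\<close>. Removing the root of the
  first tree gives a linear recursion for them, from which their convolution identity in \<open>q\<close>
  follows; its case \<open>1 + 1 = 2\<close> yields the recursion for \<open>W\<close>.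
\<close>

unbundle fps_syntax

section \<open>Weighted plane forests\<close>

text \<open>By the cycle lemma, a share \<open>q / (l + k)\<close> of all sequences of
  \<open>l\<close> leaves and \<open>k\<close> inner nodes with \<open>l + k - q\<close> children in
  total encodes a forest. Both case distinctions override totalized arithmetic: the empty forest
  would meet a division by zero, and more trees than nodes a truncated difference.\<close>

definition forest_coeff :: "real fps \<Rightarrow> nat \<Rightarrow> nat \<Rightarrow> nat \<Rightarrow> real" where
  "forest_coeff F q l k =
     (if l + k = 0 then of_bool (q = 0)
      else real q / real (l + k) * real ((l + k) choose k) *
           (if q \<le> l + k then (F ^ k) $ (l + k - q) else 0))"

lemma fps_power_Suc_nth: "(F ^ Suc k) $ n = (\<Sum>d\<le>n. F $ d * (F ^ k) $ (n - d))" for F :: "real fps"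
  by (simp add: fps_mult_nth atLeast0AtMost)

text \<open>Comparison of coefficients in the derivative of \<open>F ^ Suc k\<close>. Equivalently,
  by symmetry each of the \<open>Suc k\<close> factors carries the fraction \<open>1 / Suc k\<close>
  of the degree \<open>n\<close>.\<close>

lemma fps_power_weighted_nth:
  fixes F :: "real fps"
  shows "real (Suc k) * (\<Sum>d\<le>n. real d * F $ d * (F ^ k) $ (n - d)) = real n * (F ^ Suc k) $ n"
proof (cases n)
  case 0
  then show ?thesis by simp
next
  case (Suc n')
  have "real n * (F ^ Suc k) $ n = fps_deriv (F ^ Suc k) $ n'"
    by (simp add: Suc del: power_Suc)
  also have "fps_deriv (F ^ Suc k) = of_nat (Suc k) * (fps_deriv F * F ^ k)"
    by (simp only: fps_deriv_power' diff_Suc_1 mult.assoc)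
  also have "\<dots> $ n' = real (Suc k) * (fps_deriv F * F ^ k) $ n'"
    by (simp only: fps_of_nat[symmetric] fps_mult_left_const_nth)
  also have "(fps_deriv F * F ^ k) $ n' =
      (\<Sum>d\<le>n'. real (Suc d) * F $ (Suc d) * (F ^ k) $ (n' - d))"
    by (simp add: fps_mult_nth atLeast0AtMost)
  also have "\<dots> = (\<Sum>d\<le>n. real d * F $ d * (F ^ k) $ (n - d))"
    by (simp add: Suc sum.atMost_Suc_shift del: of_nat_Suc sum.atMost_Suc)
  finally show ?thesis by simp
qed

lemma forest_coeff_zero_trees: "forest_coeff F 0 l k = of_bool (l = 0 \<and> k = 0)"
  by (auto simp: forest_coeff_def)

lemma forest_coeff_eq_0: "l + k < q \<Longrightarrow> forest_coeff F q l k = 0"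
  by (auto simp: forest_coeff_def)

text \<open>The root of the first tree is either a leaf, which leaves \<open>q\<close> trees, or an
  inner node with \<open>d\<close> children, of weight \<open>F $ d\<close>, whose subtrees join the
  other \<open>q\<close> trees. The closed form is checked directly by Pascal's rule and
  absorption.\<close>

lemma forest_coeff_Suc:
  assumes "l + k > 0"
  shows "forest_coeff F (Suc q) l k = (if l > 0 then forest_coeff F q (l - 1) k else 0) +
     (if k > 0 then \<Sum>d\<le>l + k. F $ d * forest_coeff F (q + d) l (k - 1) else 0)"
proof -
  \<comment> \<open>In the third case at least one node remains after removing a root, so the
    denominators below are nonzero.\<close>
  consider "l + k \<le> q" | "l + k = 1" "q = 0" | "Suc q \<le> l + k" "2 \<le> l + k"
    using assms by linarith
  then show ?thesis
  proof cases
    case 1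
    then show ?thesis using assms by (auto simp: forest_coeff_eq_0)
  next
    case 2
    then have "l = 1 \<and> k = 0 \<or> l = 0 \<and> k = 1" by linarith
    then show ?thesis using 2 by (auto simp: forest_coeff_def)
  next
    case 3
    define m where "m = l + k"
    \<comment> \<open>The total number of children: the roots are the only nodes that are nobody's
      child, and there are \<open>Suc q\<close> of them.\<close>
    define M where "M = m - Suc q"
    have m: "m \<ge> 2" "m = M + Suc q" using 3 by (auto simp: m_def M_def)
    show ?thesis
    proof (cases k)
      case 0
      then show ?thesis using 3 by (auto simp: forest_coeff_def)
    next
      case (Suc k')
      let ?P = "(F ^ k) $ M"
      let ?C = "real ((m - 1) choose (k - 1))"
      \<comment> \<open>Every forest in the sum over \<open>d\<close> has \<open>m - 1\<close>
        nodes, \<open>k - 1\<close> of them inner, so all share the binomial \<open>?C\<close>. The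
        factor \<open>q + d\<close> then splits the sum into a plain and a degree-weighted
        convolution.\<close>
      have b: "forest_coeff F (q + d) l k' =
          (if d \<le> M then real (q + d) / real (m - 1) * ?C * (F ^ k') $ (M - d) else 0)"
        for d
        using 3 m unfolding forest_coeff_def m_def by (auto simp: Suc)
      have "(\<Sum>d\<le>l + k. F $ d * forest_coeff F (q + d) l k') =
          (\<Sum>d\<le>M. F $ d * forest_coeff F (q + d) l k')"
        using m m_def by (intro sum.mono_neutral_right) (auto simp: b)
      also have "\<dots> = (\<Sum>d\<le>M. ?C / real (m - 1) * (real q * (F $ d * (F ^ k') $ (M - d)) +
           real d * F $ d * (F ^ k') $ (M - d)))"
        by (rule sum.cong) (simp_all add: b add_divide_distrib ring_distribs mult_ac)
      also have "\<dots> = ?C / real (m - 1) * (real q * (\<Sum>d\<le>M. F $ d * (F ^ k') $ (M - d)) +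
           (\<Sum>d\<le>M. real d * F $ d * (F ^ k') $ (M - d)))"
        by (simp only: sum_distrib_left sum.distrib distrib_left)
      also have "(\<Sum>d\<le>M. F $ d * (F ^ k') $ (M - d)) = ?P"
        by (simp only: Suc fps_power_Suc_nth)
      also have "(\<Sum>d\<le>M. real d * F $ d * (F ^ k') $ (M - d)) = real M / real k * ?P"
        using fps_power_weighted_nth[of k' F M]
          by (simp add: Suc field_simps del: of_nat_Suc power_Suc)
      finally have s: "(\<Sum>d\<le>l + k. F $ d * forest_coeff F (q + d) l k') =
        ?C / real (m - 1) * (real q + real M / real k) *
            ?P" by (simp only: ring_distribs mult.assoc)
      have t: "(if l > 0 then forest_coeff F q (l - 1) k else 0) =
          real q / real (m - 1) * real ((m - 1) choose k) * ?P"
        using 3 unfolding forest_coeff_def m_def M_def by (auto simp: Suc)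
      \<comment> \<open>Pascal's rule merges the leaf term with the \<open>q\<close> part of the
        other one; absorption (\<open>A\<close>) rewrites \<open>?C / real k\<close> so that only
        \<open>m choose k\<close> remains.\<close>
      have C: "real (m choose k) = real ((m - 1) choose k) + ?C"
        using m by (cases m) (auto simp: Suc)
      have A: "real m * ?C = real k * real (m choose k)"
        using m Suc times_binomial_minus1_eq[of k m] by (metis of_nat_mult zero_less_Suc)
      have "forest_coeff F (Suc q) l k = real (Suc q) / real m * real (m choose k) * ?P"
        using 3 by (simp add: forest_coeff_def m_def M_def)
      also have "\<dots> = real q / real (m - 1) * real ((m - 1) choose k) * ?P + ?C / real (m - 1) *
          (real q + real M / real k) * ?P"
      proof -
        have r: "real (m - 1) = real m - 1" "real M = real m - real q - 1" using m by auto
        have k0: "real k > 0" "real m > 1" using Suc m by auto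
        have "?C / real k = real (m choose k) / real m"
          using A k0 by (simp add: field_simps)
        moreover have "real q * real ((m - 1) choose k) + ?C * (real q + real M / real k)
           = real q * real (m choose k) + real M * (?C / real k)"
          by (simp add: C ring_distribs)
        ultimately have "real q * real ((m - 1) choose k) + ?C * (real q + real M / real k)
           = real q * real (m choose k) + real M * (real (m choose k) / real m)"
          by (simp only:)
        also have "\<dots> = real (m - 1) * (real (Suc q) / real m * real (m choose k))"
          using k0 unfolding r by (simp add: field_simps)
        finally have e: "real q * real ((m - 1) choose k) + ?C * (real q + real M / real k) =
            real (m - 1) * (real (Suc q) / real m * real (m choose k))" .
        have "real q / real (m - 1) * real ((m - 1) choose k) * ?P + ?C / real (m - 1) *
            (real q + real M / real k) * ?P
          = (real q * real ((m - 1) choose k) + ?C * (real q + real M / real k)) / real (m - 1) *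
              ?P"
          by (simp add: add_divide_distrib ring_distribs)
        then show ?thesis unfolding e using k0 r by simp
      qed
      finally show ?thesis using s t by (simp add: Suc)
    qed
  qed
qed

text \<open>A list of \<open>p + q\<close> trees is cut after the \<open>p\<close>-th in exactly one
  way. Removing the first root takes one node away but may raise \<open>p\<close>, hence the
  induction on \<open>l + k\<close> with \<open>p\<close> arbitrary; both sides obey the recursion
  of \<open>forest_coeff_Suc\<close>.\<close>

lemma forest_coeff_convolution:
  "(\<Sum>l1\<le>l. \<Sum>k1\<le>k. forest_coeff F p l1 k1 * forest_coeff F q (l - l1) (k - k1)) =
      forest_coeff F (p + q) l k"
proof (induction "l + k" arbitrary: l k p rule: less_induct)
  case less
  show ?case
  proof (cases p)
    case 0
    have "(\<Sum>l1\<le>l. \<Sum>k1\<le>k. forest_coeff F p l1 k1 * forest_coeff F q (l - l1) (k - k1)) =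
      (\<Sum>l1\<le>l. if l1 = 0 then (\<Sum>k1\<le>k. if k1 = 0 then forest_coeff F q l k else 0) else 0)"
      by (intro sum.cong refl) (auto simp: 0 forest_coeff_zero_trees intro!: sum.neutral sum.cong)
    then show ?thesis by (simp add: 0)
  next
    case (Suc p')
    show ?thesis
    proof (cases "l + k = 0")
      case True
      then show ?thesis by (simp add: forest_coeff_def Suc)
    next
      case False
      let ?g = "\<lambda>q l1 k1. forest_coeff F q (l - l1) (k - k1)"
      define A where "A l1 k1 = (if l1 > 0 then forest_coeff F p' (l1 - 1) k1 else 0)" for l1 k1
      \<comment> \<open>The bound on \<open>d\<close> is \<open>l + k\<close> instead of
        \<open>l1 + k1\<close>, so that the sum over \<open>d\<close> can be moved outside; the
        extra terms vanish since they ask for more trees than nodes.\<close>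
      define B where "B l1 k1 = (if k1 > 0 then \<Sum>d\<le>l + k. F $ d * forest_coeff F (p' +
          d) l1 (k1 - 1) else 0)" for l1 k1
      have r: "forest_coeff F p l1 k1 = A l1 k1 + B l1 k1" if "l1 \<le> l" "k1 \<le> k" for l1 k1
      proof (cases "l1 + k1 = 0")
        case True
        then show ?thesis by (simp add: A_def B_def Suc forest_coeff_def)
      next
        case F: False
        have "(\<Sum>d\<le>l1 + k1. F $ d * forest_coeff F (p' + d) l1 (k1 - 1)) =
            (\<Sum>d\<le>l + k. F $ d * forest_coeff F (p' + d) l1 (k1 - 1))"
          if "k1 > 0"
          using that \<open>l1 \<le> l\<close> \<open>k1 \<le> k\<close>
            by (intro sum.mono_neutral_left) (auto simp: forest_coeff_eq_0)
        then show ?thesis using F unfolding Suc by (simp add: forest_coeff_Suc A_def B_def)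
      qed
      have a: "(\<Sum>l1\<le>l. \<Sum>k1\<le>k. A l1 k1 * ?g q l1 k1) =
          (if l > 0 then forest_coeff F (p' + q) (l - 1) k else 0)"
      proof (cases l)
        case 0
        then show ?thesis by (simp add: A_def)
      next
        case (Suc l')
        have "(\<Sum>l1\<le>l. \<Sum>k1\<le>k. A l1 k1 * ?g q l1 k1) =
            (\<Sum>l1\<le>l'. \<Sum>k1\<le>k. forest_coeff F p' l1 k1 * forest_coeff F q (l' - l1) (k - k1))"
          unfolding Suc sum.atMost_Suc_shift by (simp add: A_def Suc)
        also have "\<dots> = forest_coeff F (p' + q) l' k" using less[of l' k p'] Suc by simp
        finally show ?thesis by (simp add: Suc)
      qed
      have b: "(\<Sum>l1\<le>l. \<Sum>k1\<le>k. B l1 k1 * ?g q l1 k1) =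
         (if k > 0 then \<Sum>d\<le>l + k. F $ d * forest_coeff F (p' + q + d) l (k - 1) else 0)"
      proof (cases k)
        case 0
        then show ?thesis by (simp add: B_def)
      next
        case (Suc k')
        have "(\<Sum>l1\<le>l. \<Sum>k1\<le>k. B l1 k1 * ?g q l1 k1) = (\<Sum>l1\<le>l. \<Sum>k1\<le>k'. \<Sum>d\<le>l+k.
            F $ d * (forest_coeff F (p' + d) l1 k1 * forest_coeff F q (l - l1) (k' - k1)))"
          unfolding Suc sum.atMost_Suc_shift
            by (simp add: B_def Suc sum_distrib_right mult.assoc del: sum.atMost_Suc)
        also have "\<dots> = (\<Sum>d\<le>l+k. F $ d * (\<Sum>l1\<le>l. \<Sum>k1\<le>k'. forest_coeff F (p' + d) l1 k1 *
            forest_coeff F q (l - l1) (k' - k1)))"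
          unfolding sum_distrib_left
            by (subst sum.swap[of _ "{..l+k}"]) (intro sum.cong[OF refl] sum.swap)
        also have "\<dots> = (\<Sum>d\<le>l+k. F $ d * forest_coeff F (p' + d + q) l k')"
          using less[of l k'] Suc by simp
        finally show ?thesis by (simp add: Suc add_ac)
      qed
      have "(\<Sum>l1\<le>l. \<Sum>k1\<le>k. forest_coeff F p l1 k1 * ?g q l1 k1) =
          (\<Sum>l1\<le>l. \<Sum>k1\<le>k. A l1 k1 * ?g q l1 k1 + B l1 k1 * ?g q l1 k1)"
        by (intro sum.cong refl) (simp add: r ring_distribs)
      also have "\<dots> = forest_coeff F (Suc (p' + q)) l k"
        using False by (simp add: sum.distrib a b forest_coeff_Suc)
      finally show ?thesis by (simp add: Suc)
    qed
  qed
qed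

text \<open>An \<open>N\<close>-gon with \<open>m\<close> chords corresponds to a plane tree with \<open>N - 1\<close> leaves and \<open>m + 1\<close> inner nodes.\<close>

definition dissection_coeff :: "real fps \<Rightarrow> nat \<Rightarrow> nat \<Rightarrow> real" where
  "dissection_coeff F N m = forest_coeff F (Suc 0) (N - 1) (Suc m)"

lemma dissection_coeff_0: "N \<ge> 2 \<Longrightarrow> dissection_coeff F N 0 = F $ (N - 1)"
  by (simp add: dissection_coeff_def forest_coeff_def)

text \<open>A forest of two trees with \<open>N\<close> leaves and \<open>m + 1\<close> inner nodes
  is evaluated twice. By convolution, the cases where one tree is a single leaf give
  \<open>2 * dissection_coeff F N m\<close> and the rest is the sum; by the closed form the total is
  \<open>2 * (N + m) / N\<close> times \<open>dissection_coeff F N m\<close>.\<close>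

lemma dissection_coeff_quadratic:
  assumes "N \<ge> 2" "F $ 0 = 0"
  shows "2 * real m * dissection_coeff F N m =
     real N * (\<Sum>l = 1..<N. \<Sum>i<m. dissection_coeff F (l + 1) i * dissection_coeff F (N - l +
         1) (m - 1 - i))"
proof -
  let ?f = "forest_coeff F (Suc 0)"
  have f0: "?f l 0 = of_bool (l = 1)" for l by (simp add: forest_coeff_def)
  \<comment> \<open>As \<open>F $ 0 = 0\<close>, inner nodes have children, so every tree has a
    leaf; this removes \<open>l = 0\<close> and \<open>l = N\<close>.\<close>
  have fz: "?f 0 k = 0" for k
    using assms by (auto simp: forest_coeff_def fps_nth_power_0 startsby_zero_power_prefix)
  \<comment> \<open>If \<open>k1\<close> is \<open>0\<close> or \<open>m + 1\<close>, one tree has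
    no inner node and is a single leaf, so the leaf counts are \<open>1\<close> and
    \<open>N - 1\<close>.\<close>
  have inner: "(\<Sum>k1\<le>Suc m. ?f l k1 * ?f (N - l) (Suc m - k1)) =
     of_bool (l = 1) * ?f (N - 1) (Suc m) + ?f (N - 1) (Suc m) * of_bool (N - l = 1) +
     (\<Sum>i<m. dissection_coeff F (l + 1) i * dissection_coeff F (N - l +
         1) (m - 1 - i))" if l: "l \<in> {1..<N}" for l
  proof -
    have "(\<Sum>k1\<le>Suc m. ?f l k1 * ?f (N - l) (Suc m - k1)) =
       ?f l 0 * ?f (N - l) (Suc m) + (\<Sum>i<m. ?f l (Suc i) * ?f (N - l) (m - i)) + ?f l (Suc m) *
           ?f (N - l) 0"
      unfolding sum.atMost_Suc_shift by (simp add: lessThan_Suc_atMost[symmetric])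
    moreover have "l = N - 1" if "N - l = 1" using l that by auto
    moreover have "(\<Sum>i<m. ?f l (Suc i) * ?f (N - l) (m - i)) =
        (\<Sum>i<m. dissection_coeff F (l + 1) i * dissection_coeff F (N - l + 1) (m - 1 - i))"
      by (intro sum.cong refl) (auto simp: dissection_coeff_def Suc_diff_Suc)
    ultimately show ?thesis by (auto simp: f0)
  qed
  let ?S = "\<Sum>l = 1..<N. \<Sum>i<m. dissection_coeff F (l + 1) i * dissection_coeff F (N - l +
      1) (m - 1 - i)"
  have "forest_coeff F 2 N (Suc m) = (\<Sum>l\<le>N. \<Sum>k1\<le>Suc m. ?f l k1 * ?f (N - l) (Suc m - k1))"
    using forest_coeff_convolution[of F 1 1 N "Suc m"]
      by (simp add: numeral_2_eq_2 del: sum.atMost_Suc)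
  also have "\<dots> = (\<Sum>l = 1..<N. \<Sum>k1\<le>Suc m. ?f l k1 * ?f (N - l) (Suc m - k1))"
    by (rule sum.mono_neutral_right) (auto simp: fz not_le not_less intro!: sum.neutral)
  also have "\<dots> = (\<Sum>l = 1..<N. of_bool (l =
      1) * dissection_coeff F N m + dissection_coeff F N m * of_bool (N - l = 1) +
      (\<Sum>i<m. dissection_coeff F (l + 1) i * dissection_coeff F (N - l + 1) (m - 1 - i)))"
    by (intro sum.cong refl) (simp only: inner dissection_coeff_def)
  also have "\<dots> = 2 * dissection_coeff F N m + ?S"
  proof -
    have "(\<Sum>l = 1..<N. of_bool (l = 1) * dissection_coeff F N m) =
        (\<Sum>l\<in>{1::nat}. dissection_coeff F N m)"
      using assms by (intro sum.mono_neutral_cong_right) auto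
    moreover have "(\<Sum>l = 1..<N. dissection_coeff F N m * of_bool (N - l = 1)) =
        (\<Sum>l\<in>{N - 1}. dissection_coeff F N m)"
      using assms by (intro sum.mono_neutral_cong_right) auto
    ultimately show ?thesis by (simp only: sum.distrib) simp
  qed
  finally have 1: "forest_coeff F 2 N (Suc m) = 2 * dissection_coeff F N m + ?S" .
  \<comment> \<open>Both closed forms read \<open>F ^ Suc m\<close> at degree
    \<open>N + m - 1\<close>, so only prefactors and binomials differ; absorption relates
    them.\<close>
  have 2: "real N * forest_coeff F 2 N (Suc m) = 2 * real (N + m) * dissection_coeff F N m"
  proof -
    let ?P = "(F ^ Suc m) $ (N + Suc m - 2)"
    have b: "real N * real ((N + Suc m) choose Suc m) =
        real (N + Suc m) * real ((N + m) choose Suc m)"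
      using binomial_absorb_comp[of "N + Suc m" "Suc m"]
      by (simp only: of_nat_mult[symmetric] add_diff_cancel_right' add_Suc_right
        diff_Suc_1 diff_Suc_Suc)
    have "real N * forest_coeff F 2 N (Suc m) =
        2 / real (N + Suc m) * (real N * real ((N + Suc m) choose Suc m)) * ?P"
      using assms by (simp add: forest_coeff_def field_simps)
    also have "\<dots> = 2 * real ((N + m) choose Suc m) * ?P"
      unfolding b by (simp del: of_nat_add)
    also have "\<dots> = 2 * real (N + m) * dissection_coeff F N m"
    proof -
      have "N - 1 + Suc m = N + m" "N + m - 1 = N + Suc m - 2" using assms by auto
      moreover have "real (N + m) \<noteq> 0" using assms by simp
      ultimately show ?thesis
        using assms by (simp add: dissection_coeff_def forest_coeff_def del: of_nat_add)
    qed
    finally show ?thesis .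
  qed
  show ?thesis using 2 unfolding 1 by (simp add: algebra_simps)
qed

text \<open>The factor \<open>N - l\<close> counts the vertex pairs at distance \<open>l\<close>.
  The inner sum is symmetric under \<open>l\<close> to \<open>N - l\<close>, so averaging replaces
  this factor by \<open>N / 2\<close>, which leads to the quadratic identity.\<close>

lemma dissection_coeff_marked_chord:
  assumes "N \<ge> 2" "F $ 0 = 0"
  shows "(\<Sum>l = 1..<N. real (N - l) * (\<Sum>i<m. dissection_coeff F (l + 1) i *
      dissection_coeff F (N - l + 1) (m - 1 - i))) = real m * dissection_coeff F N m"
proof -
  define H where "H l = (\<Sum>i<m. dissection_coeff F (l + 1) i * dissection_coeff F (N - l +
      1) (m - 1 - i))" for l
  have H: "H (N - l) = H l" if "l < N" for l
    unfolding H_def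
      by (rule sum.reindex_bij_witness[of _ "\<lambda>i. m - 1 - i" "\<lambda>i. m - 1 - i"]) (use that in auto)
  have "(\<Sum>l = 1..<N. real (N - l) * H l) = (\<Sum>l = 1..<N. real l * H l)"
    by (rule sum.reindex_bij_witness[of _ "\<lambda>l. N - l" "\<lambda>l. N - l"]) (use H in auto)
  then have "2 * (\<Sum>l = 1..<N. real (N - l) * H l) = (\<Sum>l =
      1..<N. real (N - l) * H l + real l * H l)"
    by (simp add: sum.distrib)
  also have "\<dots> = real N * (\<Sum>l = 1..<N. H l)"
    unfolding sum_distrib_left by (intro sum.cong refl) (auto simp: of_nat_diff algebra_simps)
  finally show ?thesis using dissection_coeff_quadratic[OF assms, of m] unfolding H_def by simp
qed

section \<open>Partial Bell polynomials as coefficients of powers\<close>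

text \<open>
  The support bound \<open>M\<close> is decoupled from \<open>n\<close> because \<open>n\<close> decreases in the induction on \<open>k\<close>.
\<close>

definition bell_indices_upto :: "nat \<Rightarrow> nat \<Rightarrow> nat \<Rightarrow> (nat \<Rightarrow> nat) set" where
  "bell_indices_upto M n k = {i. (\<forall>j. j \<notin> {1..M} \<longrightarrow> i j = 0) \<and> (\<Sum>j=1..M. i j) =
      k \<and> (\<Sum>j=1..M. j * i j) = n}"

definition bell_term :: "(nat \<Rightarrow> real) \<Rightarrow> nat \<Rightarrow> nat \<Rightarrow> (nat \<Rightarrow> nat) \<Rightarrow> real" where
  "bell_term x M k i = fact k / (\<Prod>j=1..M. fact (i j)) * (\<Prod>j=1..M. x j ^ i j)"

lemma finite_bell_indices_upto: "finite (bell_indices_upto M n k)"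
proof (rule finite_subset)
  show "bell_indices_upto M n k \<subseteq> {f. \<forall>j. (j \<in> {1..M} \<longrightarrow> f j \<in> {0..k}) \<and> (j \<notin> {1..M} \<longrightarrow> f j = 0)}"
    by (auto simp: bell_indices_upto_def intro!: member_le_sum)
  show "finite {f::nat \<Rightarrow> nat. \<forall>j. (j \<in> {1..M} \<longrightarrow> f j \<in> {0..k}) \<and> (j \<notin> {1..M} \<longrightarrow> f j = 0)}"
    by (rule finite_set_of_finite_funs) auto
qed

lemma bell_indices_upto_0: "bell_indices_upto M n 0 = (if n = 0 then {\<lambda>_. 0} else {})"
proof -
  have "i = (\<lambda>_. 0)" if "i \<in> bell_indices_upto M n 0" for i
  proof
    fix j
    show "i j = 0" using that by (cases "j \<in> {1..M}") (auto simp: bell_indices_upto_def)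
  qed
  moreover have "(\<lambda>_. 0) \<in> bell_indices_upto M n 0 \<longleftrightarrow> n = 0" by (auto simp: bell_indices_upto_def)
  ultimately show ?thesis by auto
qed

text \<open>Raising the multiplicity of the part size \<open>d\<close> inverts the removal of a part
  in the induction on \<open>k\<close>. The last equation is the quotient of two multinomial terms,
  multiplied out.\<close>

lemma bell_increment:
  fixes i :: "nat \<Rightarrow> nat" and x :: "nat \<Rightarrow> real"
  assumes "d \<in> {1..M}"
  shows "(\<Sum>j=1..M. (i(d := Suc (i d))) j) = Suc (\<Sum>j=1..M. i j)"
    "(\<Sum>j=1..M. j * (i(d := Suc (i d))) j) = d + (\<Sum>j=1..M. j * i j)"
    "bell_term x M (Suc k) (i(d := Suc (i d))) * real (Suc (i d)) =
        real (Suc k) * (x d * bell_term x M k i)"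
proof -
  have rs: "sum g {1..M} = g d + sum g ({1..M} - {d})" for g :: "nat \<Rightarrow> nat"
    using assms by (intro sum.remove) auto
  have rp: "prod g {1..M} = g d * prod g ({1..M} - {d})" for g :: "nat \<Rightarrow> real"
    using assms by (intro prod.remove) auto
  have c: "(\<Sum>j\<in>{1..M} - {d}. g j ((i(d := Suc (i d))) j)) =
      (\<Sum>j\<in>{1..M} - {d}. g j (i j))" for g :: "nat \<Rightarrow> nat \<Rightarrow> nat"
    by (rule sum.cong) auto
  have p: "(\<Prod>j\<in>{1..M} - {d}. g j ((i(d := Suc (i d))) j)) =
      (\<Prod>j\<in>{1..M} - {d}. g j (i j))" for g :: "nat \<Rightarrow> nat \<Rightarrow> real"
    by (rule prod.cong) auto
  show "(\<Sum>j=1..M. (i(d := Suc (i d))) j) = Suc (\<Sum>j=1..M. i j)"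
    unfolding rs c[of "\<lambda>_ a. a"] by simp
  show "(\<Sum>j=1..M. j * (i(d := Suc (i d))) j) = d + (\<Sum>j=1..M. j * i j)"
    unfolding rs c[of "\<lambda>j a. j * a"] by simp
  show "bell_term x M (Suc k) (i(d := Suc (i d))) * real (Suc (i d)) =
      real (Suc k) * (x d * bell_term x M k i)"
  proof -
    let ?A = "\<Prod>j\<in>{1..M} - {d}. fact (i j) :: real" and ?B = "\<Prod>j\<in>{1..M} - {d}. x j ^ i j"
    have l: "bell_term x M (Suc k) (i(d := Suc (i d))) =
        fact (Suc k) / (fact (Suc (i d)) * ?A) * (x d ^ Suc (i d) * ?B)"
      unfolding bell_term_def rp p[of "\<lambda>_ a. fact a"] p[of "\<lambda>j a. x j ^ a"]
        by (simp only: fun_upd_same)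
    have r: "bell_term x M k i = fact k / (fact (i d) * ?A) * (x d ^ i d * ?B)"
      unfolding bell_term_def rp ..
    have "?A \<noteq> 0" by simp
    moreover have "real (Suc (i d)) \<noteq> 0" by simp
    ultimately show ?thesis unfolding l r by (simp add: field_simps del: of_nat_Suc)
  qed
qed

text \<open>The multinomial theorem. Each index sequence is counted with one of its
  \<open>Suc k\<close> parts distinguished: removing a distinguished part of size \<open>d\<close>
  leaves a sequence for \<open>n - d\<close> and \<open>k\<close>, which matches
  \<open>?F * ?F ^ k\<close>.\<close>

lemma fps_power_nth_eq_bell_sum:
  fixes x :: "nat \<Rightarrow> real"
  assumes "n \<le> M"
  shows "(Abs_fps (\<lambda>j. if j = 0 then 0 else x j) ^ k) $ n =
      (\<Sum>i\<in>bell_indices_upto M n k. bell_term x M k i)"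
  using assms
proof (induction k arbitrary: n)
  case 0
  then show ?case by (auto simp: bell_indices_upto_0 bell_term_def)
next
  case (Suc k)
  let ?F = "Abs_fps (\<lambda>j. if j = 0 then 0 else x j)"
  let ?I = "bell_indices_upto M n (Suc k)"
  let ?S = "\<lambda>d. {i \<in> ?I. 0 < i d}"
  \<comment> \<open>Lowering \<open>i d\<close> by one is a bijection onto the smaller indices; the
    factor \<open>i d\<close> absorbs the change of the factorial in \<open>bell_term\<close>, and
    sequences with \<open>i d = 0\<close> drop out.\<close>
  have fib: "(\<Sum>i\<in>?I. real (i d) * bell_term x M (Suc k) i) =
     (if d \<le> n then real (Suc k) * (x d *
         (\<Sum>i\<in>bell_indices_upto M (n - d) k. bell_term x M k i)) else 0)"
    if d: "d \<in> {1..M}" for d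
  proof -
    have "(\<Sum>i\<in>?I. real (i d) * bell_term x M (Suc k) i) =
        (\<Sum>i\<in>?S d. real (i d) * bell_term x M (Suc k) i)"
      by (rule sum.mono_neutral_right) (auto simp: finite_bell_indices_upto)
    also have "\<dots> = (if d \<le> n then real (Suc k) * (x d *
        (\<Sum>i\<in>bell_indices_upto M (n - d) k. bell_term x M k i)) else 0)"
    proof (cases "d \<le> n")
      case True
      have "(\<Sum>i\<in>?S d. real (i d) * bell_term x M (Suc k) i) =
          (\<Sum>i\<in>bell_indices_upto M (n - d) k. real (Suc k) * (x d * bell_term x M k i))"
      proof (rule sum.reindex_bij_witness[of _ "\<lambda>i. i(d := Suc (i d))" "\<lambda>i. i(d := i d - 1)"])
        fix i assume i: "i \<in> ?S d"
        define i' where "i' = i(d := i d - 1)"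
        have e: "i = i'(d := Suc (i' d))" using i by (auto simp: i'_def)
        have s: "(\<Sum>j=1..M. i j) = Suc (\<Sum>j=1..M. i' j)" "(\<Sum>j=1..M. j * i j) =
            d + (\<Sum>j=1..M. j * i' j)"
          "bell_term x M (Suc k) i * real (Suc (i' d)) =
              real (Suc k) * (x d * bell_term x M k i')"
          unfolding e by (simp_all only: bell_increment[OF d])
        have id: "i d = Suc (i' d)" using i by (auto simp: i'_def)
        show "(i(d := i d - 1))(d := Suc ((i(d := i d - 1)) d)) = i"
          using e unfolding i'_def by simp
        show "i(d := i d - 1) \<in> bell_indices_upto M (n - d) k"
          unfolding i'_def[symmetric] using s i d by (auto simp: bell_indices_upto_def i'_def)
        show "real (Suc k) * (x d * bell_term x M k (i(d := i d - 1))) =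
            real (i d) * bell_term x M (Suc k) i"
          using s(3) unfolding i'_def[symmetric] id[symmetric] by (simp only: mult.commute)
      next
        fix i assume i: "i \<in> bell_indices_upto M (n - d) k"
        show "(i(d := Suc (i d)))(d := (i(d := Suc (i d))) d - 1) = i" by simp
        have "i(d := Suc (i d)) \<in> ?I"
          unfolding bell_indices_upto_def mem_Collect_eq bell_increment[OF d]
          using i d True by (auto simp: bell_indices_upto_def)
        then show "i(d := Suc (i d)) \<in> ?S d" by simp
      qed
      then show ?thesis using True by (simp add: sum_distrib_left)
    next
      case False
      have "?S d = {}"
      proof (rule ccontr)
        assume "?S d \<noteq> {}"
        then obtain i where i: "i \<in> ?I" "0 < i d" by auto
        have "d \<le> d * i d" using i by simp
        also have "\<dots> \<le> (\<Sum>j=1..M. j * i j)" using d by (intro member_le_sum) auto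
        also have "\<dots> = n" using i by (simp add: bell_indices_upto_def)
        finally show False using False by simp
      qed
      then show ?thesis using False by (simp only: sum.empty if_False)
    qed
    finally show ?thesis .
  qed
  have "real (Suc k) * (\<Sum>i\<in>?I. bell_term x M (Suc k) i) =
      (\<Sum>i\<in>?I. \<Sum>d=1..M. real (i d) * bell_term x M (Suc k) i)"
    unfolding sum_distrib_left
  proof (rule sum.cong[OF refl])
    fix i assume "i \<in> ?I"
    then have "real (Suc k) = (\<Sum>d=1..M. real (i d))"
      by (auto simp: bell_indices_upto_def simp flip: of_nat_sum)
    then show "real (Suc k) * bell_term x M (Suc k) i =
        (\<Sum>d=1..M. real (i d) * bell_term x M (Suc k) i)"
      by (simp only: sum_distrib_right)
  qed
  also have "\<dots> = (\<Sum>d=1..M. \<Sum>i\<in>?I. real (i d) * bell_term x M (Suc k) i)" by (rule sum.swap)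
  also have "\<dots> = (\<Sum>d=1..M. if d \<le> n then real (Suc k) * (x d * (?F ^ k) $ (n - d)) else 0)"
    by (rule sum.cong) (use fib Suc in auto)
  \<comment> \<open>The ranges differ by zero terms only: \<open>?F $ 0 = 0\<close>, terms with
    \<open>d > n\<close> are \<open>0\<close>, and \<open>n \<le> M\<close> lets
    \<open>{1..M}\<close> reach \<open>n\<close>.\<close>
  also have "\<dots> = (\<Sum>d\<le>n. real (Suc k) * (?F $ d * (?F ^ k) $ (n - d)))"
    by (rule sum.mono_neutral_cong) (use Suc.prems in auto)
  also have "\<dots> = real (Suc k) * (?F ^ Suc k) $ n"
    by (simp only: fps_power_Suc_nth sum_distrib_left)
  finally show ?case by (simp del: of_nat_Suc power_Suc)
qed

text \<open>The arguments \<open>fact j * c j\<close> cancel every \<open>j!\<close> of the Bell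
  polynomial, and \<open>fact k / fact n\<close> turns \<open>n!\<close> into \<open>k!\<close>,
  which leaves the multinomial expansion.\<close>

lemma partial_bell_eq_fps_power_nth:
  fixes c :: "nat \<Rightarrow> real"
  shows "fact k / fact n * partial_bell n k (\<lambda>j. fact j * c j) = (Abs_fps (\<lambda>j. if j =
      0 then 0 else c j) ^ k) $ n"
proof -
  have "bell_indices n k = bell_indices_upto n n k"
    by (simp add: bell_indices_def bell_indices_upto_def)
  moreover have "fact k / fact n * (fact n / (\<Prod>j=1..n. fact (i j)) * (\<Prod>j=1..n. (fact j *
      c j / fact j) ^ i j)) = bell_term c n k i" for i
    by (simp add: bell_term_def)
  ultimately show ?thesis
    unfolding fps_power_nth_eq_bell_sum[OF order_refl] partial_bell_def sum_distrib_left by simp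
qed

lemma fps_nth_compose_X_power:
  fixes f :: "real fps"
  assumes "a > 0"
  shows "(f oo fps_X ^ a) $ m = (if a dvd m then f $ (m div a) else 0)"
proof -
  have "(f oo fps_X ^ a) $ m = (\<Sum>i = 0..m. if i * a = m then f $ i else 0)"
    by (auto simp: fps_compose_nth fps_X_power_nth mult.commute simp flip: power_mult
        intro!: sum.cong)
  also have "\<dots> = (if a dvd m then f $ (m div a) else 0)"
  proof (cases "a dvd m")
    case True
    then obtain q where q: "m = a * q" by auto
    have "(\<Sum>i = 0..m. if i * a = m then f $ i else 0) = (\<Sum>i\<in>{q}. f $ i)"
      using assms q by (intro sum.mono_neutral_cong_right) (auto simp: mult.commute)
    then show ?thesis using assms q by simp
  next
    case False
    then show ?thesis by (auto intro!: sum.neutral)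
  qed
  finally show ?thesis .
qed

section \<open>Cutting a dissection along a marked chord\<close>

text \<open>
  Polygons are taken with an arbitrary vertex set, so that the two pieces of a cut need no
  relabelling.
\<close>

definition chords_on :: "nat set \<Rightarrow> nat set set" where
  "chords_on V = {e. e \<subseteq> V \<and> card e = 2}"

text \<open>
  The multiplicity of a chord in the boundary of the polygon; it is 2 only if that polygon is a digon.
\<close>

definition side_mult :: "nat set \<Rightarrow> nat set \<Rightarrow> nat" where
  "side_mult V e = of_bool (V \<inter> {Min e<..<Max e} = {}) + of_bool (V \<subseteq> {Min e..Max e})"

definition big_parts :: "nat set \<Rightarrow> nat set multiset \<Rightarrow> nat set set" where
  "big_parts V D = {S. S \<subseteq> V \<and> 3 \<le> card S \<and> polygon_sides S \<subseteq> set_mset D \<union> polygon_sides V \<and>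
     (\<forall>e\<in>#D. e \<subseteq> S \<longrightarrow> e \<in> polygon_sides S)}"

text \<open>A chord with \<open>t > 0\<close> copies, sides included, bounds \<open>t - 1\<close>
  digons; truncated subtraction makes absent chords contribute \<open>0\<close>. Counting suffices
  since all digons have the same weight.\<close>

definition num_digons :: "nat set \<Rightarrow> nat set multiset \<Rightarrow> nat" where
  "num_digons V D = (\<Sum>e\<in>chords_on V. count D e + side_mult V e - 1)"

definition weight :: "(nat \<Rightarrow> real) \<Rightarrow> nat set \<Rightarrow> nat set multiset \<Rightarrow> real" where
  "weight w V D = (\<Prod>S\<in>big_parts V D. w (card S)) * w 2 ^ num_digons V D"

definition dissections :: "nat set \<Rightarrow> nat \<Rightarrow> nat set multiset set" where
  "dissections V m = {D. set_mset D \<subseteq> chords_on V \<and> noncrossing (set_mset D) \<and> size D = m}"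

definition total_weight :: "(nat \<Rightarrow> real) \<Rightarrow> nat set \<Rightarrow> nat \<Rightarrow> real" where
  "total_weight w V m = (\<Sum>D\<in>dissections V m. weight w V D)"

lemma chords_onE:
  assumes "e \<in> chords_on V"
  obtains x y where "e = {x, y}" "x < y" "x \<in> V" "y \<in> V"
proof -
  obtain x y where "e = {x, y}" "x \<noteq> y" using assms by (auto simp: chords_on_def card_2_iff)
  then have "e = {min x y, max x y}" "min x y < max x y" by (auto simp: min_def max_def)
  moreover have "min x y \<in> V" "max x y \<in> V"
    using assms \<open>e = {x, y}\<close> by (auto simp: chords_on_def min_def max_def)
  ultimately show ?thesis by (rule that)
qed

lemma chords_on_pair: "x < y \<Longrightarrow> {x, y} \<in> chords_on V \<longleftrightarrow> x \<in> V \<and> y \<in> V"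
  by (auto simp: chords_on_def)

lemma doubleton_less_eq_iff: "x < y \<Longrightarrow> u < v \<Longrightarrow> {x, y} = {u, v} \<longleftrightarrow> x = u \<and> y = v"
  for x y u v :: nat
  by (auto simp: doubleton_eq_iff)

lemma polygon_sides_pair:
  assumes "x < y"
  shows "{x, y} \<in> polygon_sides V \<longleftrightarrow> x \<in> V \<and> y \<in> V \<and> (V \<inter> {x<..<y} = {} \<or> V \<subseteq> {x..y})"
proof
  assume "{x, y} \<in> polygon_sides V"
  then obtain u v where uv: "{x, y} = {u, v}" "u \<in> V" "v \<in> V" "u < v" "V \<inter> {u<..<v} =
      {} \<or> V \<subseteq> {u..v}"
    unfolding polygon_sides_def by blast
  then have "x = u" "y = v" using doubleton_less_eq_iff[OF assms] by simp_all
  then show "x \<in> V \<and> y \<in> V \<and> (V \<inter> {x<..<y} = {} \<or> V \<subseteq> {x..y})" using uv by simp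
next
  assume "x \<in> V \<and> y \<in> V \<and> (V \<inter> {x<..<y} = {} \<or> V \<subseteq> {x..y})"
  then show "{x, y} \<in> polygon_sides V" unfolding polygon_sides_def using assms by blast
qed

lemma polygon_sides_subset_chords_on: "polygon_sides V \<subseteq> chords_on V"
  by (auto simp: polygon_sides_def chords_on_def)

lemma side_mult_pair:
  "x < y \<Longrightarrow> side_mult V {x, y} = of_bool (V \<inter> {x<..<y} = {}) + of_bool (V \<subseteq> {x..y})"
  by (simp add: side_mult_def)

lemma finite_chords_on: "finite V \<Longrightarrow> finite (chords_on V)"
  unfolding chords_on_def by (rule finite_subset[of _ "Pow V"]) auto

lemma finite_big_parts: "finite V \<Longrightarrow> finite (big_parts V D)"
  unfolding big_parts_def by (rule finite_subset[of _ "Pow V"]) auto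

lemma finite_dissections_on:
  assumes "finite V"
  shows "finite (dissections V m)"
proof (rule finite_subset)
  show "dissections V m \<subseteq> mset ` {xs. set xs \<subseteq> chords_on V \<and> length xs = m}"
  proof
    fix D assume "D \<in> dissections V m"
    moreover obtain xs where "mset xs = D" using ex_mset by blast
    ultimately show "D \<in> mset ` {xs. set xs \<subseteq> chords_on V \<and> length xs = m}"
      by (auto simp: dissections_def)
  qed
  show "finite (mset ` {xs. set xs \<subseteq> chords_on V \<and> length xs = m})"
    by (intro finite_imageI finite_lists_length_eq finite_chords_on assms)
qed

lemma noncrossing_subset: "noncrossing E \<Longrightarrow> E' \<subseteq> E \<Longrightarrow> noncrossing E'"
  unfolding noncrossing_def by (meson subsetD)

text \<open>The nearest elements of \<open>S\<close> below and above \<open>z\<close> are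
  neighbours, so some side passes over \<open>z\<close>. This is the source of the forbidden sides
  in \<open>big_part_cut_dichotomy\<close> and \<open>big_parts_empty\<close>.\<close>

lemma polygon_side_over_gap:
  assumes "finite S" "s \<in> S" "s < z" "t \<in> S" "z < t" "z \<notin> S"
  shows "\<exists>x y. s \<le> x \<and> x < z \<and> z < y \<and> y \<le> t \<and> {x, y} \<in> polygon_sides S \<and> S \<inter> {x<..<y} = {}"
proof -
  let ?x = "Max (S \<inter> {..<z})" and ?y = "Min (S \<inter> {z<..})"
  have x: "?x \<in> S \<inter> {..<z}" using assms by (intro Max_in) auto
  have y: "?y \<in> S \<inter> {z<..}" using assms by (intro Min_in) auto
  have gap: "S \<inter> {?x<..<?y} = {}"
  proof (rule ccontr)
    assume "S \<inter> {?x<..<?y} \<noteq> {}"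
    then obtain a where a: "a \<in> S" "?x < a" "a < ?y" by auto
    then have "a \<noteq> z" using assms(6) by auto
    then consider "a < z" | "z < a" by linarith
    then show False
    proof cases
      case 1
      then have "a \<le> ?x" using a assms(1) by (intro Max_ge) auto
      then show False using a by simp
    next
      case 2
      then have "?y \<le> a" using a assms(1) by (intro Min_le) auto
      then show False using a by simp
    qed
  qed
  have "s \<le> ?x" using assms by (intro Max_ge) auto
  moreover have "?y \<le> t" using assms by (intro Min_le) auto
  moreover have "{?x, ?y} \<in> polygon_sides S" using x y gap by (simp add: polygon_sides_pair)
  ultimately show ?thesis using x y gap by (intro exI[of _ ?x] exI[of _ ?y]) simp
qed

section \<open>The two pieces of a polygon cut along a chord\<close>

locale chord_cut =
  fixes V :: "nat set" and u v :: nat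
  assumes finV: "finite V" and uV: "u \<in> V" and vV: "v \<in> V" and uv: "u < v"
begin

definition "V1 = V \<inter> {u..v}"
definition "V2 = V - {u<..<v}"
definition "e0 = {u, v}"

lemma finite_V1_V2: "finite V1" "finite V2"
  using finV by (auto simp: V1_def V2_def)

lemma V1_V2_subset: "V1 \<subseteq> V" "V2 \<subseteq> V" by (auto simp: V1_def V2_def)

lemma e0_mem: "e0 \<in> chords_on V" "e0 \<in> chords_on V1" "e0 \<in> chords_on V2"
  using uV vV uv by (auto simp: e0_def chords_on_pair V1_def V2_def)

lemma V1_Int_V2: "V1 \<inter> V2 = {u, v}"
  using uV vV uv by (auto simp: V1_def V2_def)

lemma common_chord: "e \<in> chords_on V1 \<Longrightarrow> e \<in> chords_on V2 \<Longrightarrow> e = e0"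
proof -
  assume "e \<in> chords_on V1" "e \<in> chords_on V2"
  then have "e \<subseteq> {u, v}" "card e = 2" using V1_Int_V2 by (auto simp: chords_on_def)
  then show "e = e0" unfolding e0_def using uv by (intro card_subset_eq) auto
qed

lemma side_mult_e0: "side_mult V1 e0 = 1 + of_bool (V \<inter> {u<..<v} = {})"
   "side_mult V2 e0 = 1 + of_bool (V \<subseteq> {u..v})"
   "side_mult V e0 = of_bool (V \<inter> {u<..<v} = {}) + of_bool (V \<subseteq> {u..v})"
proof -
  have "V1 \<inter> {u<..<v} = V \<inter> {u<..<v}" "V1 \<subseteq> {u..v}" "V2 \<inter> {u<..<v} = {}" "V2 \<subseteq> {u..v} \<longleftrightarrow>
      V \<subseteq> {u..v}"
    by (auto simp: V1_def V2_def)
  then show "side_mult V1 e0 = 1 + of_bool (V \<inter> {u<..<v} = {})"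
   "side_mult V2 e0 = 1 + of_bool (V \<subseteq> {u..v})"
   "side_mult V e0 = of_bool (V \<inter> {u<..<v} = {}) + of_bool (V \<subseteq> {u..v})"
    using uv by (simp_all add: e0_def side_mult_pair)
qed

text \<open>A chord of \<open>V1\<close> other than \<open>e0\<close> leaves out \<open>u\<close> or
  \<open>v\<close>, so it cannot be the long closing side of either polygon; strictly between its
  ends \<open>V1\<close> and \<open>V\<close> agree.\<close>

lemma side_V1:
  assumes xy: "x < y" "{x, y} \<in> chords_on V1" "{x, y} \<noteq> e0"
  shows "V1 \<inter> {x<..<y} = V \<inter> {x<..<y}" "\<not> V1 \<subseteq> {x..y}" "\<not> V \<subseteq> {x..y}"
proof -
  have "x \<in> V1" "y \<in> V1" "x \<noteq> u \<or> y \<noteq> v" using xy by (auto simp: chords_on_pair e0_def)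
  then show "V1 \<inter> {x<..<y} = V \<inter> {x<..<y}" "\<not> V1 \<subseteq> {x..y}" "\<not> V \<subseteq> {x..y}"
  proof -
    have m: "u \<le> x" "y \<le> v" "u < x \<or> y < v"
      using \<open>x \<in> V1\<close> \<open>y \<in> V1\<close> \<open>x \<noteq> u \<or> y \<noteq> v\<close> by (auto simp: V1_def)
    show "V1 \<inter> {x<..<y} = V \<inter> {x<..<y}" using m by (auto simp: V1_def)
    have "u \<in> V1" "v \<in> V1" using uV vV uv by (auto simp: V1_def)
    moreover have "u \<notin> {x..y} \<or> v \<notin> {x..y}" using m by auto
    ultimately show "\<not> V1 \<subseteq> {x..y}" "\<not> V \<subseteq> {x..y}" using V1_V2_subset(1) by blast+
  qed
qed

text \<open>A chord of \<open>V2\<close> other than \<open>e0\<close> either avoids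
  \<open>{u<..<v}\<close> or spans \<open>u\<close> and \<open>v\<close> with one of them strictly
  inside, so the deleted vertices change neither test.\<close>

lemma side_V2:
  assumes xy: "x < y" "{x, y} \<in> chords_on V2" "{x, y} \<noteq> e0"
  shows "V2 \<inter> {x<..<y} = {} \<longleftrightarrow> V \<inter> {x<..<y} = {}" "V2 \<subseteq> {x..y} \<longleftrightarrow> V \<subseteq> {x..y}"
proof -
  have m: "x \<in> V" "y \<in> V" "x \<le> u \<or> v \<le> x" "y \<le> u \<or> v \<le> y" "x \<noteq> u \<or> y \<noteq> v"
    using xy by (auto simp: chords_on_pair e0_def V2_def)
  have uv2: "u \<in> V2" "v \<in> V2" using uv uV vV by (auto simp: V2_def)
  show "V2 \<inter> {x<..<y} = {} \<longleftrightarrow> V \<inter> {x<..<y} = {}"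
  proof
    assume *: "V2 \<inter> {x<..<y} = {}"
    then have "u \<notin> {x<..<y}" "v \<notin> {x<..<y}" using uv2 by auto
    then have "{x<..<y} \<inter> {u<..<v} = {}" using m xy(1) uv by auto
    then show "V \<inter> {x<..<y} = {}" using * unfolding V2_def by blast
  qed (auto simp: V2_def)
  show "V2 \<subseteq> {x..y} \<longleftrightarrow> V \<subseteq> {x..y}"
  proof
    assume *: "V2 \<subseteq> {x..y}"
    then have "x \<le> u" "v \<le> y" using uv2 by auto
    then have "{u<..<v} \<subseteq> {x..y}" by auto
    then show "V \<subseteq> {x..y}" using * unfolding V2_def by blast
  qed (auto simp: V2_def)
qed

text \<open>Such a chord crosses \<open>e0\<close>: one end of \<open>e0\<close> lies strictly
  between \<open>x\<close> and \<open>y\<close> and the other outside, so both tests for a side of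
  \<open>V\<close> fail.\<close>

lemma side_neither:
  assumes xy: "x < y" "{x, y} \<in> chords_on V" "{x, y} \<notin> chords_on V1" "{x, y} \<notin> chords_on V2"
  shows "V \<inter> {x<..<y} \<noteq> {}" "\<not> V \<subseteq> {x..y}"
    "u < x \<and> x < v \<and> v < y \<or> x < u \<and> u < y \<and> y < v"
proof -
  have "x \<in> V" "y \<in> V" using xy by (auto simp: chords_on_pair)
  then have *: "u < x \<and> x < v \<and> v < y \<or> x < u \<and> u < y \<and> y < v"
    using xy by (auto simp: chords_on_pair V1_def V2_def)
  then show "V \<inter> {x<..<y} \<noteq> {}" "\<not> V \<subseteq> {x..y}" "u < x \<and> x < v \<and> v < y \<or> x < u \<and> u < y \<and> y < v"
    using uV vV by auto
qed

text \<open>Compared chord by chord. Only \<open>e0\<close> belongs to both pieces: it is an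
  additional side of each, which makes up for the lost marked copy and for the \<open>1\<close>
  being subtracted twice.\<close>

lemma num_digons_cut:
  assumes D: "set_mset D1 \<subseteq> chords_on V1" "set_mset D2 \<subseteq> chords_on V2"
  shows "num_digons V (add_mset e0 (D1 + D2)) = num_digons V1 D1 + num_digons V2 D2"
proof -
  let ?c = "\<lambda>V D e. count D e + side_mult V e - 1"
  have ext: "num_digons U E = (\<Sum>e\<in>chords_on V. if e \<in> chords_on U then ?c U E e else 0)"
    if "U \<subseteq> V" for U E
    unfolding num_digons_def
    by (rule sum.mono_neutral_cong_left)
      (use that finV in \<open>auto simp: finite_chords_on chords_on_def\<close>)
  have "?c V (add_mset e0 (D1 + D2)) e =
     (if e \<in> chords_on V1 then ?c V1 D1 e else 0) + (if e \<in> chords_on V2 then ?c V2 D2 e else 0)"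
    if e: "e \<in> chords_on V" for e
  proof -
    obtain x y where xy: "e = {x, y}" "x < y" "x \<in> V" "y \<in> V" using e by (rule chords_onE)
    have c0: "count D1 e = 0" if "e \<notin> chords_on V1" using D that by (auto simp: count_eq_zero_iff)
    have c2: "count D2 e = 0" if "e \<notin> chords_on V2" using D that by (auto simp: count_eq_zero_iff)
    consider "e = e0" | "e \<noteq> e0" "e \<in> chords_on V1" | "e \<noteq> e0" "e \<in> chords_on V2"
      | "e \<noteq> e0" "e \<notin> chords_on V1" "e \<notin> chords_on V2"
      by blast
    then show ?thesis
    proof cases
      case 1
      then show ?thesis using e0_mem by (simp add: side_mult_e0)
    next
      case 2
      then have "e \<notin> chords_on V2" using common_chord by blast
      moreover have "side_mult V1 e = side_mult V e"
        using 2 xy side_V1[of x y] by (simp add: side_mult_pair)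
      ultimately show ?thesis using 2 c2 by simp
    next
      case 3
      then have "e \<notin> chords_on V1" using common_chord by blast
      moreover have "side_mult V2 e = side_mult V e"
        using 3 xy side_V2[of x y] by (simp add: side_mult_pair)
      ultimately show ?thesis using 3 c0 by simp
    next
      case 4
      then have "side_mult V e = 0" using xy e side_neither[of x y] by (simp add: side_mult_pair)
      then show ?thesis using 4 c0 c2 by simp
    qed
  qed
  then have "num_digons V (add_mset e0 (D1 + D2)) = (\<Sum>e\<in>chords_on V.
      (if e \<in> chords_on V1 then ?c V1 D1 e else 0) +
          (if e \<in> chords_on V2 then ?c V2 D2 e else 0))"
    unfolding num_digons_def by (rule sum.cong[OF refl])
  also have "\<dots> = num_digons V1 D1 + num_digons V2 D2"
    by (simp only: sum.distrib ext[OF V1_V2_subset(1)] ext[OF V1_V2_subset(2)])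
  finally show ?thesis .
qed

lemma sides_cut:
  assumes "e \<noteq> e0"
  shows "e \<in> polygon_sides V1 \<longleftrightarrow> e \<in> polygon_sides V \<and> e \<in> chords_on V1"
    "e \<in> polygon_sides V2 \<longleftrightarrow> e \<in> polygon_sides V \<and> e \<in> chords_on V2"
proof -
  have "(e \<in> polygon_sides V1 \<longleftrightarrow> e \<in> polygon_sides V \<and> e \<in> chords_on V1) \<and>
    (e \<in> polygon_sides V2 \<longleftrightarrow> e \<in> polygon_sides V \<and> e \<in> chords_on V2)"
  proof (cases "e \<in> chords_on V")
    case True
    then obtain x y where xy: "e = {x, y}" "x < y" "x \<in> V" "y \<in> V" by (rule chords_onE)
    have "e \<in> polygon_sides V1 \<longleftrightarrow> e \<in> polygon_sides V \<and> e \<in> chords_on V1"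
      using side_V1[of x y] assms xy by (auto simp: polygon_sides_pair chords_on_pair)
    moreover have "e \<in> polygon_sides V2 \<longleftrightarrow> e \<in> polygon_sides V \<and> e \<in> chords_on V2"
      using side_V2[of x y] assms xy by (auto simp: polygon_sides_pair chords_on_pair)
    ultimately show ?thesis by blast
  next
    case False
    moreover have "chords_on V1 \<subseteq> chords_on V" "chords_on V2 \<subseteq> chords_on V"
      using V1_V2_subset by (auto simp: chords_on_def)
    ultimately show ?thesis using polygon_sides_subset_chords_on by blast
  qed
  then show "e \<in> polygon_sides V1 \<longleftrightarrow> e \<in> polygon_sides V \<and> e \<in> chords_on V1"
    "e \<in> polygon_sides V2 \<longleftrightarrow> e \<in> polygon_sides V \<and> e \<in> chords_on V2" by auto
qed

lemma e0_side: "e0 \<in> polygon_sides V1" "e0 \<in> polygon_sides V2"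
  using uv uV vV by (auto simp: e0_def polygon_sides_pair V1_def V2_def)

lemma e0_side_sub: "e0 \<subseteq> S \<Longrightarrow> S \<subseteq> V1 \<Longrightarrow> e0 \<in> polygon_sides S"
   "e0 \<subseteq> S \<Longrightarrow> S \<subseteq> V2 \<Longrightarrow> e0 \<in> polygon_sides S"
  using uv by (auto simp: e0_def polygon_sides_pair V1_def V2_def)

text \<open>Chords of different pieces cannot cross, and \<open>e0\<close> counts as a chord of
  either piece, so a crossing can only occur inside \<open>D1\<close> or inside
  \<open>D2\<close>.\<close>

lemma noncrossing_cut:
  assumes D: "set_mset D1 \<subseteq> chords_on V1" "set_mset D2 \<subseteq> chords_on V2"
  shows "noncrossing (set_mset (add_mset e0 (D1 + D2))) \<longleftrightarrow>
      noncrossing (set_mset D1) \<and> noncrossing (set_mset D2)"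
proof
  assume "noncrossing (set_mset D1) \<and> noncrossing (set_mset D2)"
  then have n: "noncrossing (set_mset D1)" "noncrossing (set_mset D2)" by auto
  have 1: "(e = e0 \<or> e \<in># D1) \<Longrightarrow> e \<in> chords_on V1" for e using D e0_mem by auto
  have 2: "(e = e0 \<or> e \<in># D2) \<Longrightarrow> e \<in> chords_on V2" for e using D e0_mem by auto
  show "noncrossing (set_mset (add_mset e0 (D1 + D2)))"
    unfolding noncrossing_def
  proof (intro allI impI notI)
    fix p q x y assume *: "{p, q} \<in> set_mset (add_mset e0 (D1 +
        D2))" "{x, y} \<in> set_mset (add_mset e0 (D1 + D2))"
      "p < x \<and> x < q \<and> q < y"
    have "\<not> ({p, q} \<in># D1 \<and> {x, y} \<in># D1)" "\<not> ({p, q} \<in># D2 \<and> {x, y} \<in># D2)"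
      using n * unfolding noncrossing_def by blast+
    moreover have "{p, q} = e0 \<or> {p, q} \<in># D1 \<or> {p, q} \<in># D2" "{x, y} =
        e0 \<or> {x, y} \<in># D1 \<or> {x, y} \<in># D2"
      using * by auto
    ultimately have "{p, q} \<in> chords_on V1 \<and> {x, y} \<in> chords_on V2 \<or> {p, q} \<in> chords_on V2 \<and>
        {x, y} \<in> chords_on V1"
      using 1 2 by blast
    moreover have "p < q" "x < y" using *(3) by auto
    ultimately show False using *(3) uv by (auto simp: chords_on_pair V1_def V2_def)
  qed
next
  assume n: "noncrossing (set_mset (add_mset e0 (D1 + D2)))"
  show "noncrossing (set_mset D1) \<and> noncrossing (set_mset D2)"
    by (intro conjI noncrossing_subset[OF n]) auto
qed

text \<open>Suppose \<open>S\<close> has a vertex \<open>p\<close> strictly between \<open>u\<close>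
  and \<open>v\<close> and a vertex \<open>q\<close> beyond. No side of \<open>S\<close> crosses
  \<open>e0\<close>: it would not be in \<open>D\<close>, and separating \<open>u\<close> from
  \<open>v\<close> it would not be a side of \<open>V\<close>. This forces \<open>u\<close> and
  \<open>v\<close> into \<open>S\<close>, so \<open>e0\<close> must be a side of \<open>S\<close>,
  yet \<open>p\<close> and \<open>q\<close> lie on different sides of it.\<close>

lemma big_part_cut_dichotomy:
  assumes "S \<in> big_parts V D" "e0 \<in># D" "noncrossing (set_mset D)"
  shows "S \<subseteq> V1 \<or> S \<subseteq> V2"
proof (rule ccontr)
  assume "\<not> (S \<subseteq> V1 \<or> S \<subseteq> V2)"
  moreover have SV: "S \<subseteq> V" and sides: "polygon_sides S \<subseteq> set_mset D \<union> polygon_sides V"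
    and e0S: "e0 \<subseteq> S \<Longrightarrow> e0 \<in> polygon_sides S"
    using assms by (auto simp: big_parts_def)
  ultimately obtain p q where p: "p \<in> S" "u < p" "p < v" and q: "q \<in> S" "q < u \<or> v < q"
    by (auto simp: V1_def V2_def not_le subset_iff)
  have finS: "finite S" using SV finV by (rule finite_subset)
  have no: False
    if xy: "{x, y} \<in> polygon_sides S" "u < x \<and> x < v \<and> v < y \<or> x < u \<and> u < y \<and> y < v" for x y
  proof -
    have "x < y" using xy(2) by auto
    have "\<not> {x, y} \<in># D" using assms(2,3) xy(2) unfolding noncrossing_def e0_def by blast
    then have "{x, y} \<in> polygon_sides V" using sides xy(1) by auto
    then show False using xy(2) uV vV by (auto simp: polygon_sides_pair[OF \<open>x < y\<close>])
  qed
  note gap = polygon_side_over_gap[OF finS]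
  have mm: "{Min S, Max S} \<in> polygon_sides S" if "Min S < Max S"
    using that finS p by (auto simp: polygon_sides_pair intro!: Min_in Max_in)
  have bnd: "Min S \<le> p" "p \<le> Max S" "Min S \<le> q" "q \<le> Max S" using finS p q by auto
  have mem: "Min S \<in> S" "Max S \<in> S" using finS p by (auto intro!: Min_in Max_in)
  \<comment> \<open>On both ways from \<open>p\<close> to \<open>q\<close>, the boundary of \<open>S\<close> must pass through an end of the chord.\<close>
  have "v \<in> S"
  proof (rule ccontr)
    assume v: "v \<notin> S"
    show False
    proof (cases "v < Max S")
      case True
      then obtain x y where "x < v" "v < y" "{x, y} \<in> polygon_sides S" "p \<le> x"
        using gap[of p v "Max S"] p v mem by auto
      then show False using no[of x y] p by auto
    next
      \<comment> \<open>Now \<open>q < u\<close>, and the closing side \<open>{Min S, Max S}\<close>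
        crosses \<open>e0\<close>.\<close>
      case False
      then have "Max S < v" using v mem by (metis linorder_neqE_nat)
      then show False using bnd q p no[OF mm] by auto
    qed
  qed
  moreover have "u \<in> S"
  proof (rule ccontr)
    assume u: "u \<notin> S"
    show False
    proof (cases "Min S < u")
      case True
      then obtain x y where "x < u" "u < y" "{x, y} \<in> polygon_sides S" "y \<le> p"
        using gap[of "Min S" u p] p u mem by auto
      then show False using no[of x y] p by auto
    next
      case False
      then have "u < Min S" using u mem by (metis linorder_neqE_nat)
      then show False using bnd q p no[OF mm] by auto
    qed
  qed
  ultimately have "e0 \<in> polygon_sides S" using e0S by (simp add: e0_def)
  then show False using p q uv by (auto simp: e0_def polygon_sides_pair)
qed

text \<open>Inside one piece the conditions on \<open>S\<close> agree: chords and sides other than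
  \<open>e0\<close> are inherited, \<open>e0\<close> is a side of the piece, and if \<open>S\<close>
  contains both ends of \<open>e0\<close>, then \<open>e0\<close> is a side of \<open>S\<close> and
  cuts nothing.\<close>

lemma big_parts_cut:
  assumes D: "set_mset D1 \<subseteq> chords_on V1" "set_mset D2 \<subseteq> chords_on V2"
    and n: "noncrossing (set_mset D1)" "noncrossing (set_mset D2)"
  shows "big_parts V (add_mset e0 (D1 + D2)) = big_parts V1 D1 \<union> big_parts V2 D2"
proof (intro set_eqI iffI)
  let ?D = "add_mset e0 (D1 + D2)"
  have sub: "polygon_sides S \<subseteq> chords_on U" if "S \<subseteq> U" for S U
    using polygon_sides_subset_chords_on[of S] that by (auto simp: chords_on_def)
  have D1': "e = e0" if "e \<in># D2" "e \<in> chords_on V1" for e using D that common_chord by blast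
  have D2': "e = e0" if "e \<in># D1" "e \<in> chords_on V2" for e using D that common_chord by blast
  fix S
  {
    assume S: "S \<in> big_parts V ?D"
    then have "S \<subseteq> V1 \<or> S \<subseteq> V2"
      by (rule big_part_cut_dichotomy) (use n noncrossing_cut[OF D] in simp_all)
    moreover have "S \<in> big_parts V1 D1" if "S \<subseteq> V1"
    proof -
      have "e \<in> set_mset D1 \<union> polygon_sides V1" if e: "e \<in> polygon_sides S" for e
      proof -
        have "e \<in> chords_on V1" using sub[OF \<open>S \<subseteq> V1\<close>] e by blast
        moreover have "e = e0 \<or> e \<in># D1 \<or> e \<in># D2 \<or> e \<in> polygon_sides V"
          using S e by (auto simp: big_parts_def)
        ultimately show ?thesis using D1' e0_side sides_cut[of e] by blast
      qed
      then show ?thesis using S that by (auto simp: big_parts_def)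
    qed
    moreover have "S \<in> big_parts V2 D2" if "S \<subseteq> V2"
    proof -
      have "e \<in> set_mset D2 \<union> polygon_sides V2" if e: "e \<in> polygon_sides S" for e
      proof -
        have "e \<in> chords_on V2" using sub[OF \<open>S \<subseteq> V2\<close>] e by blast
        moreover have "e = e0 \<or> e \<in># D1 \<or> e \<in># D2 \<or> e \<in> polygon_sides V"
          using S e by (auto simp: big_parts_def)
        ultimately show ?thesis using D2' e0_side sides_cut[of e] by blast
      qed
      then show ?thesis using S that by (auto simp: big_parts_def)
    qed
    ultimately show "S \<in> big_parts V1 D1 \<union> big_parts V2 D2" by blast
  next
    assume "S \<in> big_parts V1 D1 \<union> big_parts V2 D2"
    then show "S \<in> big_parts V ?D"
    proof
      assume S: "S \<in> big_parts V1 D1"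
      then have S': "S \<subseteq> V1" "polygon_sides S \<subseteq> set_mset D1 \<union> polygon_sides V1"
        by (auto simp: big_parts_def)
      have "e \<in> polygon_sides S" if "e \<in># ?D" "e \<subseteq> S" for e
      proof -
        have "e \<in> chords_on V1" using that D S' e0_mem by (auto simp: chords_on_def)
        then have "e = e0 \<or> e \<in># D1" using D1' that by auto
        then show ?thesis using S that e0_side_sub S' by (auto simp: big_parts_def)
      qed
      moreover have "e \<in> set_mset ?D \<union> polygon_sides V" if "e \<in> polygon_sides S" for e
        using S'(2) that sides_cut[of e] by (cases "e = e0") auto
      moreover have "S \<subseteq> V" "3 \<le> card S" using S S'(1) V1_V2_subset by (auto simp: big_parts_def)
      ultimately show ?thesis unfolding big_parts_def by blast
    next
      assume S: "S \<in> big_parts V2 D2"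
      then have S': "S \<subseteq> V2" "polygon_sides S \<subseteq> set_mset D2 \<union> polygon_sides V2"
        by (auto simp: big_parts_def)
      have "e \<in> polygon_sides S" if "e \<in># ?D" "e \<subseteq> S" for e
      proof -
        have "e \<in> chords_on V2" using that D S' e0_mem by (auto simp: chords_on_def)
        then have "e = e0 \<or> e \<in># D2" using D2' that by auto
        then show ?thesis using S that e0_side_sub S' by (auto simp: big_parts_def)
      qed
      moreover have "e \<in> set_mset ?D \<union> polygon_sides V" if "e \<in> polygon_sides S" for e
        using S'(2) that sides_cut[of e] by (cases "e = e0") auto
      moreover have "S \<subseteq> V" "3 \<le> card S" using S S'(1) V1_V2_subset by (auto simp: big_parts_def)
      ultimately show ?thesis unfolding big_parts_def by blast
    qed
  }
qed

text \<open>No part with three vertices fits into \<open>V1 \<inter> V2 = {u, v}\<close>, so the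
  product over the big parts splits.\<close>

lemma weight_cut:
  assumes D: "set_mset D1 \<subseteq> chords_on V1" "set_mset D2 \<subseteq> chords_on V2"
    and n: "noncrossing (set_mset D1)" "noncrossing (set_mset D2)"
  shows "weight w V (add_mset e0 (D1 + D2)) = weight w V1 D1 * weight w V2 D2"
proof -
  have "big_parts V1 D1 \<inter> big_parts V2 D2 = {}"
  proof (rule ccontr)
    assume "\<not> ?thesis"
    then obtain S where "S \<subseteq> V1" "S \<subseteq> V2" "3 \<le> card S" unfolding big_parts_def by blast
    then have "S \<subseteq> {u, v}" "3 \<le> card S" using V1_Int_V2 by blast+
    moreover have "card S \<le> card {u, v}" using \<open>S \<subseteq> {u, v}\<close> by (intro card_mono) auto
    ultimately show False using uv by simp
  qed
  then show ?thesis
    by (simp add: weight_def big_parts_cut[OF assms] num_digons_cut[OF D]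
        prod.union_disjoint finite_V1_V2 finite_big_parts power_add)
qed

lemma dissections_split:
  assumes "D \<in> dissections V m" "e0 \<in># D"
  shows "e \<in># D \<Longrightarrow> e \<in> chords_on V1 \<or> e \<in> chords_on V2"
proof (rule ccontr)
  assume e: "e \<in># D" "\<not> (e \<in> chords_on V1 \<or> e \<in> chords_on V2)"
  then have "e \<in> chords_on V" using assms by (auto simp: dissections_def)
  then obtain x y where xy: "e = {x, y}" "x < y" "x \<in> V" "y \<in> V" by (rule chords_onE)
  have "u < x \<and> x < v \<and> v < y \<or> x < u \<and> u < y \<and> y < v"
    using side_neither[of x y] e xy \<open>e \<in> chords_on V\<close> by auto
  moreover have "noncrossing (set_mset D)" using assms by (auto simp: dissections_def)
  ultimately show False using xy(1) e(1) assms(2) unfolding noncrossing_def e0_def by blast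
qed

text \<open>The multiplicity of \<open>e0\<close> is expanded into a sum over the marked copy
  \<open>t\<close>. Gluing two dissections along an added \<open>e0\<close> inverts the cut, with
  \<open>t\<close> recovered as \<open>count D1 e0\<close>.\<close>

lemma sum_marked_chord:
  "(\<Sum>D\<in>dissections V (Suc m). real (count D e0) * weight w V D) =
     (\<Sum>i\<le>m. total_weight w V1 i * total_weight w V2 (m - i))"
proof -
  let ?L = "SIGMA D : dissections V (Suc m). {..<count D e0}"
  let ?R = "SIGMA i : {..m}. dissections V1 i \<times> dissections V2 (m - i)"
  \<comment> \<open>\<open>t\<close> of the copies of the marked chord parallel to the marked one go to \<open>V1\<close>, the rest to \<open>V2\<close>.\<close>
  define P1 where "P1 D t = filter_mset (\<lambda>e. e \<in> chords_on V1 \<and> e \<noteq> e0) D +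
      replicate_mset t e0" for D t
  define P2 where "P2 D t = filter_mset (\<lambda>e. e \<notin> chords_on V1) D +
      replicate_mset (count D e0 - Suc t) e0" for D and t :: nat
  have glue: "add_mset e0 (P1 D t + P2 D t) = D" if "t < count D e0" for D t
    using that by (intro multiset_eqI) (auto simp: P1_def P2_def e0_mem)
  have P1V: "set_mset (P1 D t) \<subseteq> chords_on V1" for D t using e0_mem by (auto simp: P1_def)
  have P2V: "set_mset (P2 D t) \<subseteq> chords_on V2" if "D \<in> dissections V n" "t < count D e0" for D t n
  proof -
    have "e0 \<in># D" using that(2) by (metis count_greater_zero_iff gr0I not_less0)
    then show ?thesis
      using e0_mem dissections_split[OF that(1)] by (auto simp: P2_def split: if_splits)
  qed
  have "(\<Sum>D\<in>dissections V (Suc m). real (count D e0) * weight w V D) = (\<Sum>(D, t)\<in>?L. weight w V D)"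
    by (subst sum.Sigma[symmetric]) (auto simp: finite_dissections_on finV)
  also have "\<dots> = (\<Sum>(i, D1, D2)\<in>?R. weight w V1 D1 * weight w V2 D2)"
  proof (rule sum.reindex_bij_witness[of _
        "\<lambda>(i, D1, D2). (add_mset e0 (D1 + D2), count D1 e0)"
        "\<lambda>(D, t). (size (P1 D t), P1 D t, P2 D t)"])
    fix a assume "a \<in> ?L"
    then obtain D t where a: "a = (D, t)" "D \<in> dissections V (Suc m)" "t < count D e0" by auto
    note b = glue[OF a(3)]
    have sz: "Suc (size (P1 D t) + size (P2 D t)) = Suc m"
      using arg_cong[OF b, of size] a(2) by (simp add: dissections_def)
    have nc: "noncrossing (set_mset (P1 D t)) \<and> noncrossing (set_mset (P2 D t))"
      using noncrossing_cut[OF P1V[of D t] P2V[OF a(2,3)]] b a(2) by (simp add: dissections_def)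
    show "(case case a of (D, t) \<Rightarrow> (size (P1 D t), P1 D t, P2 D t) of
          (i, D1, D2) \<Rightarrow> (add_mset e0 (D1 + D2), count D1 e0)) = a"
      using b by (simp add: a) (simp add: P1_def)
    show "(case a of (D, t) \<Rightarrow> (size (P1 D t), P1 D t, P2 D t)) \<in> ?R"
      using sz nc P1V P2V[OF a(2,3)] by (auto simp: a dissections_def)
    show "(case case a of (D, t) \<Rightarrow> (size (P1 D t), P1 D t, P2 D t) of
          (i, D1, D2) \<Rightarrow> weight w V1 D1 * weight w V2 D2) = (case a of (D, t) \<Rightarrow> weight w V D)"
      using weight_cut[OF P1V[of D t] P2V[OF a(2,3)], of w] nc b by (simp add: a)
  next
    fix r assume "r \<in> ?R"
    then obtain i D1 D2 where r: "r =
        (i, D1, D2)" "i \<le> m" "D1 \<in> dissections V1 i" "D2 \<in> dissections V2 (m - i)" by auto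
    then have D: "set_mset D1 \<subseteq> chords_on V1" "set_mset D2 \<subseteq> chords_on V2"
      and n: "noncrossing (set_mset D1)" "noncrossing (set_mset D2)" and sz: "size D1 =
          i" "size D2 = m - i"
      by (auto simp: dissections_def)
    have z1: "count D1 e = 0"
      if "e \<notin> chords_on V1" for e using D that by (auto simp: count_eq_zero_iff)
    have z2: "count D2 e = 0" if "e \<in> chords_on V1" "e \<noteq> e0" for e
      using D that common_chord by (auto simp: count_eq_zero_iff)
    have "P1 (add_mset e0 (D1 + D2)) (count D1 e0) = D1"
      by (rule multiset_eqI) (auto simp: P1_def z1 z2)
    moreover have "P2 (add_mset e0 (D1 + D2)) (count D1 e0) = D2"
      using e0_mem by (intro multiset_eqI) (auto simp: P2_def z1 z2)
    ultimately show "(case case r of (i, D1, D2) \<Rightarrow> (add_mset e0 (D1 + D2), count D1 e0) of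
          (D, t) \<Rightarrow> (size (P1 D t), P1 D t, P2 D t)) = r"
      by (simp add: r sz)
    have "chords_on V1 \<subseteq> chords_on V" "chords_on V2 \<subseteq> chords_on V"
      using V1_V2_subset by (auto simp: chords_on_def)
    then show "(case r of (i, D1, D2) \<Rightarrow> (add_mset e0 (D1 + D2), count D1 e0)) \<in> ?L"
      using D n sz r(2) noncrossing_cut[OF D] e0_mem by (auto simp: r(1) dissections_def)
  qed
  also have "\<dots> = (\<Sum>i\<le>m. \<Sum>(D1, D2)\<in>dissections V1 i \<times> dissections V2 (m - i). weight w V1 D1 *
      weight w V2 D2)"
    by (subst sum.Sigma[symmetric]) (auto simp: finite_dissections_on finite_V1_V2)
  also have "\<dots> = (\<Sum>i\<le>m. total_weight w V1 i * total_weight w V2 (m - i))"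
    by (simp add: total_weight_def sum_product sum.cartesian_product)
  finally show ?thesis .
qed

lemma card_cut: "card V1 + card V2 = card V + 2"
proof -
  have "V1 \<union> V2 = V" by (auto simp: V1_def V2_def)
  then show ?thesis using card_Un_Int[OF finite_V1_V2] V1_Int_V2 uv by simp
qed

end

section \<open>Undissected polygons and the recursion for the total weight\<close>

lemma dissections_0: "dissections V 0 = {{#}}"
  by (auto simp: dissections_def) (simp add: noncrossing_def)

lemma subset_doubleton_of_gap:
  fixes x y :: nat
  assumes "S \<inter> {x<..<y} = {}" "S \<subseteq> {x..y}"
  shows "S \<subseteq> {x, y}"
proof
  fix a assume "a \<in> S"
  then have "a \<notin> {x<..<y}" "a \<in> {x..y}" using assms by blast+
  then show "a \<in> {x, y}" by auto
qed

text \<open>If \<open>S\<close> misses a vertex \<open>z\<close> of \<open>V\<close>, some side of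
  \<open>S\<close> has \<open>z\<close> on one hand and the rest of \<open>S\<close> on the other. A
  side of \<open>V\<close> cannot separate vertices of \<open>V\<close>, so \<open>S\<close> would
  consist of two points.\<close>

lemma big_parts_empty:
  assumes "finite V" "3 \<le> card V"
  shows "big_parts V {#} = {V}"
proof -
  have "S = V" if S: "S \<subseteq> V" "3 \<le> card S" "polygon_sides S \<subseteq> polygon_sides V" for S
  proof (rule ccontr)
    assume "S \<noteq> V"
    then obtain z where z: "z \<in> V" "z \<notin> S" using S by auto
    have finS: "finite S" using assms S(1) by (auto intro: finite_subset)
    have S2: False if "S \<subseteq> {x, y}" for x y
    proof -
      have "card S \<le> card {x, y}" using that by (intro card_mono) auto
      also have "\<dots> \<le> 2" by (simp add: card_insert_if)
      finally show False using S(2) by simp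
    qed
    have "S \<noteq> {}" using S by auto
    let ?m = "Min S" and ?M = "Max S"
    have mM: "?m \<in> S" "?M \<in> S" "S \<subseteq> {?m..?M}" using finS \<open>S \<noteq> {}\<close> by (auto intro: Min_in Max_in)
    have "?m \<noteq> ?M" using mM S2[of ?m ?M] by auto
    moreover have "?m \<le> ?M" using mM by auto
    ultimately have lt: "?m < ?M" by simp
    show False
    proof (cases "?m < z \<and> z < ?M")
      case True
      then obtain x y where x: "x < z" and y: "z < y" and side: "{x, y} \<in> polygon_sides S"
        and gap: "S \<inter> {x<..<y} = {}"
        using polygon_side_over_gap[OF finS mM(1) _ mM(2) _ z(2)] by blast
      have xy: "x < y" using x y by simp
      have "{x, y} \<in> polygon_sides V" using S(3) side by auto
      then have "V \<inter> {x<..<y} = {} \<or> V \<subseteq> {x..y}" using xy by (simp add: polygon_sides_pair)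
      moreover have "z \<in> V \<inter> {x<..<y}" using z x y by auto
      ultimately have "V \<subseteq> {x..y}" by blast
      then have "S \<subseteq> {x, y}" using gap S(1) by (intro subset_doubleton_of_gap) auto
      then show False by (rule S2)
    next
      \<comment> \<open>Here \<open>z\<close> is below or above all of \<open>S\<close>, and the
        separating side is \<open>{Min S, Max S}\<close>.\<close>
      case False
      have "{?m, ?M} \<in> polygon_sides S" using mM lt by (simp add: polygon_sides_pair)
      then have "{?m, ?M} \<in> polygon_sides V" using S(3) by auto
      then have "V \<inter> {?m<..<?M} = {} \<or> V \<subseteq> {?m..?M}" using lt by (simp add: polygon_sides_pair)
      moreover have "z \<notin> {?m..?M}"
        using False z(2) mM by (metis atLeastAtMost_iff order_le_imp_less_or_eq)
      ultimately have "V \<inter> {?m<..<?M} = {}" using z by blast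
      then have "S \<subseteq> {?m, ?M}" using mM(3) S(1) by (intro subset_doubleton_of_gap) auto
      then show False by (rule S2)
    qed
  qed
  then show ?thesis using assms by (auto simp: big_parts_def)
qed

lemma weight_empty:
  assumes "finite V" "2 \<le> card V"
  shows "weight w V {#} = w (card V)"
proof (cases "card V = 2")
  case True
  have "V \<in> chords_on V" using True by (simp add: chords_on_def)
  then obtain x y where xy: "V = {x, y}" "x < y" by (rule chords_onE)
  have "big_parts V {#} = {}"
  proof (rule ccontr)
    assume "big_parts V {#} \<noteq> {}"
    then obtain S where "S \<subseteq> V" "3 \<le> card S" unfolding big_parts_def by blast
    then show False using card_mono[OF assms(1), of S] True by simp
  qed
  moreover have "chords_on V = {V}"
    proof -
    have "e = V"
      if "e \<subseteq> V" "card e = 2" for e using card_subset_eq[OF assms(1) that(1)] that True by simp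
    then show ?thesis using True by (auto simp: chords_on_def)
  qed
  \<comment> \<open>The two sides of a digon are copies of the chord \<open>V\<close>, so
    \<open>num_digons\<close> is \<open>2 - 1 = 1\<close> and the weight is
    \<open>w 2\<close>.\<close>
  moreover have "side_mult V V = 2"
    using xy by (auto simp: side_mult_pair)
  ultimately show ?thesis using True by (simp add: weight_def num_digons_def)
next
  case False
  then have 3: "3 \<le> card V" using assms by simp
  have "side_mult V e \<le> 1" if e: "e \<in> chords_on V" for e
  proof (rule ccontr)
    obtain x y where xy: "e = {x, y}" "x < y" "x \<in> V" "y \<in> V" using e by (rule chords_onE)
    assume "\<not> side_mult V e \<le> 1"
    then have "V \<inter> {x<..<y} = {}" "V \<subseteq> {x..y}"
      using xy by (simp_all add: side_mult_pair of_bool_def split: if_splits)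
    then have "V \<subseteq> {x, y}" by (intro subset_doubleton_of_gap)
    then have "card V \<le> card {x, y}" by (intro card_mono) auto
    then show False using 3 xy by simp
  qed
  then have "num_digons V {#} = 0" by (simp add: num_digons_def)
  then show ?thesis using big_parts_empty[OF assms(1) 3] by (simp add: weight_def)
qed

lemma total_weight_0:
  assumes "finite V" "2 \<le> card V"
  shows "total_weight w V 0 = w (card V)"
  using weight_empty[OF assms] by (simp add: total_weight_def dissections_0)

text \<open>\<open>Suc m\<close> is the number of choices of a marked chord, counted with
  multiplicity; after exchanging the sums each vertex pair is handled by
  \<open>sum_marked_chord\<close>.\<close>

lemma total_weight_Suc:
  assumes "finite V"
  shows "real (Suc m) * total_weight w V (Suc m) = (\<Sum>(u, v)\<in>{(u, v). u \<in> V \<and> v \<in> V \<and> u < v}.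
     \<Sum>i\<le>m. total_weight w (V \<inter> {u..v}) i * total_weight w (V - {u<..<v}) (m - i))"
proof -
  have sz: "real (Suc m) = (\<Sum>e\<in>chords_on V. real (count D e))"
    if "D \<in> dissections V (Suc m)" for D
  proof -
    have "size D = (\<Sum>e\<in>set_mset D. count D e)" by (rule size_multiset_overloaded_eq)
    also have "\<dots> = (\<Sum>e\<in>chords_on V. count D e)"
      using that assms by (intro sum.mono_neutral_left)
        (auto simp: finite_chords_on dissections_def count_eq_zero_iff)
    finally show ?thesis using that by (simp add: dissections_def flip: of_nat_sum)
  qed
  have "real (Suc m) * total_weight w V (Suc m) =
      (\<Sum>D\<in>dissections V (Suc m). \<Sum>e\<in>chords_on V. real (count D e) * weight w V D)"
    unfolding total_weight_def sum_distrib_left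
      by (rule sum.cong[OF refl]) (simp only: sz sum_distrib_right)
  also have "\<dots> = (\<Sum>e\<in>chords_on V. \<Sum>D\<in>dissections V (Suc m). real (count D e) * weight w V D)"
    by (rule sum.swap)
  also have "\<dots> = (\<Sum>(u, v)\<in>{(u, v). u \<in> V \<and> v \<in> V \<and>
      u < v}. \<Sum>D\<in>dissections V (Suc m). real (count D {u, v}) * weight w V D)"
  proof (rule sum.reindex_bij_witness[of _ "\<lambda>(u, v). {u, v}" "\<lambda>e. (Min e, Max e)"])
    fix e assume "e \<in> chords_on V"
    then obtain x y where "e = {x, y}" "x < y" "x \<in> V" "y \<in> V" by (rule chords_onE)
    then show "(case (Min e, Max e) of (u, v) \<Rightarrow> {u, v}) =
        e" "(Min e, Max e) \<in> {(u, v). u \<in> V \<and> v \<in> V \<and> u < v}"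
      "(case (Min e, Max e) of (u, v) \<Rightarrow> \<Sum>D\<in>dissections V (Suc m). real (count D {u, v}) *
          weight w V D) =
         (\<Sum>D\<in>dissections V (Suc m). real (count D e) * weight w V D)"
      by auto
  qed (auto simp: chords_on_pair)
  also have "\<dots> = (\<Sum>(u, v)\<in>{(u, v). u \<in> V \<and> v \<in> V \<and> u < v}.
     \<Sum>i\<le>m. total_weight w (V \<inter> {u..v}) i * total_weight w (V - {u<..<v}) (m - i))"
  proof (rule sum.cong[OF refl], clarify)
    fix u v assume "u \<in> V" "v \<in> V" "u < v"
    then interpret chord_cut V u v using assms by unfold_locales
    show "(\<Sum>D\<in>dissections V (Suc m). real (count D {u, v}) * weight w V D) =
       (\<Sum>i\<le>m. total_weight w (V \<inter> {u..v}) i * total_weight w (V - {u<..<v}) (m - i))"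
      using sum_marked_chord[where m = m and w = w] unfolding e0_def V1_def V2_def .
  qed
  finally show ?thesis .
qed

text \<open>\<open>card (V \<inter> {u..v}) - 1\<close> is the distance of \<open>u\<close> and
  \<open>v\<close> in the increasing enumeration \<open>h\<close> of \<open>V\<close>, and
  \<open>card V - l\<close> pairs have distance \<open>l\<close>.\<close>

lemma sum_pairs_card:
  fixes H :: "nat \<Rightarrow> real" and V :: "nat set"
  assumes "finite V"
  shows "(\<Sum>(u, v)\<in>{(u, v). u \<in> V \<and> v \<in> V \<and> u < v}. H (card (V \<inter> {u..v}) - 1)) =
     (\<Sum>l = 1..<card V. real (card V - l) * H l)"
proof -
  let ?N = "card V"
  obtain h where h: "bij_betw h {..<?N} V" "strict_mono_on {..<?N} h"
    using ex_bij_betw_strict_mono_card[OF assms] by blast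
  have inj: "inj_on h {..<?N}" and im: "h ` {..<?N} = V" using h by (auto simp: bij_betw_def)
  have lt: "h i < h j \<longleftrightarrow> i < j" if "i < ?N" "j < ?N" for i j
    using h(2) that by (meson lessThan_iff strict_mono_on_less)
  have le: "h i \<le> h j \<longleftrightarrow> i \<le> j" if "i < ?N" "j < ?N" for i j
    using lt[OF that(2,1)] by linarith
  have card: "card (V \<inter> {h i..h j}) - 1 = j - i" if "i < j" "j < ?N" for i j
  proof -
    have "V \<inter> {h i..h j} = h ` {i..j}"
    proof (intro set_eqI iffI)
      fix z assume z: "z \<in> V \<inter> {h i..h j}"
      then obtain q where "q < ?N" "z = h q" using im by (metis IntD1 imageE lessThan_iff)
      then show "z \<in> h ` {i..j}" using z le[of i q] le[of q j] that by auto
    next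
      fix z assume "z \<in> h ` {i..j}"
      then obtain q where "z = h q" "i \<le> q" "q \<le> j" by auto
      then show "z \<in> V \<inter> {h i..h j}" using le[of i q] le[of q j] that im by auto
    qed
    moreover have "inj_on h {i..j}" using that by (intro inj_on_subset[OF inj]) auto
    ultimately show ?thesis using that by (simp add: card_image)
  qed
  have "{(u, v). u \<in> V \<and> v \<in> V \<and> u < v} = (\<lambda>(i, j). (h i, h j)) ` {(i, j). i < j \<and> j < ?N}"
  proof (intro set_eqI iffI)
    fix p assume "p \<in> {(u, v). u \<in> V \<and> v \<in> V \<and> u < v}"
    then obtain u v where p: "p = (u, v)" "u \<in> V" "v \<in> V" "u < v" by auto
    obtain i j where "u = h i" "v = h j" "i < ?N" "j < ?N"
      using p(2,3) im by (metis imageE lessThan_iff)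
    then have "p = (h i, h j)" "i < ?N" "j < ?N" "h i < h j" using p by auto
    then show "p \<in> (\<lambda>(i, j). (h i, h j)) ` {(i, j). i < j \<and> j < ?N}" using lt[of i j] by auto
  next
    fix p assume "p \<in> (\<lambda>(i, j). (h i, h j)) ` {(i, j). i < j \<and> j < ?N}"
    then obtain i j where "p = (h i, h j)" "i < j" "j < ?N" by auto
    then show "p \<in> {(u, v). u \<in> V \<and> v \<in> V \<and> u < v}" using lt[of i j] im by auto
  qed
  moreover have "inj_on (\<lambda>(i, j). (h i, h j)) {(i, j). i < j \<and> j < ?N}"
    using inj by (auto simp: inj_on_def)
  ultimately have "(\<Sum>(u, v)\<in>{(u, v). u \<in> V \<and> v \<in> V \<and> u < v}. H (card (V \<inter> {u..v}) - 1)) =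
     (\<Sum>(i, j)\<in>{(i, j). i < j \<and> j < ?N}. H (card (V \<inter> {h i..h j}) - 1))"
    by (simp add: sum.reindex case_prod_unfold)
  also have "\<dots> = (\<Sum>(i, j)\<in>{(i, j). i < j \<and> j < ?N}. H (j - i))"
    by (rule sum.cong) (auto simp: card simp del: One_nat_def)
  also have "\<dots> = (\<Sum>(l, i)\<in>(SIGMA l:{1..<?N}. {..<?N - l}). H l)"
    by (rule sum.reindex_bij_witness[of _ "\<lambda>(l, i). (i, i + l)" "\<lambda>(i, j). (j - i, i)"]) auto
  also have "\<dots> = (\<Sum>l = 1..<?N. real (?N - l) * H l)"
    by (subst sum.Sigma[symmetric]) auto
  finally show ?thesis .
qed

text \<open>Both sides satisfy the marked-chord recursion and agree for \<open>m = 0\<close>. A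
  \<open>Suc d\<close>-gon is an inner node with \<open>d\<close> children, one of its sides facing
  the root; hence the shift in \<open>F\<close>. The pieces are other polygons, so \<open>V\<close>
  stays arbitrary.\<close>

lemma total_weight_eq_dissection_coeff:
  fixes w :: "nat \<Rightarrow> real"
  assumes "finite V" "2 \<le> card V"
  defines "F \<equiv> Abs_fps (\<lambda>d. if d = 0 then 0 else w (Suc d))"
  shows "total_weight w V m = dissection_coeff F (card V) m"
  using assms(1,2)
proof (induction m arbitrary: V rule: less_induct)
  case (less m)
  have F0: "F $ 0 = 0" by (simp add: F_def)
  show ?case
  proof (cases m)
    case 0
    then show ?thesis using less.prems
      by (simp add: total_weight_0 dissection_coeff_0 F_def Suc_diff_Suc numeral_2_eq_2)
  next
    case (Suc m')
    let ?N = "card V"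
    define H where "H l = (\<Sum>i<m. dissection_coeff F (l + 1) i * dissection_coeff F (?N - l +
        1) (m - 1 - i))" for l
    let ?P = "{(u, v). u \<in> V \<and> v \<in> V \<and> u < v}"
    have "real m * total_weight w V m =
        (\<Sum>(u, v)\<in>?P. \<Sum>i\<le>m'. total_weight w (V \<inter> {u..v}) i * total_weight w (V - {u<..<v}) (m' - i))"
      unfolding Suc by (rule total_weight_Suc[OF less.prems(1)])
    also have "\<dots> = (\<Sum>(u, v)\<in>?P. H (card (V \<inter> {u..v}) - 1))"
    proof (rule sum.cong[OF refl], clarify)
      fix u v assume uv: "u \<in> V" "v \<in> V" "u < v"
      then interpret chord_cut V u v using less.prems by unfold_locales
      have "card {u, v} \<le> card V1" "card {u, v} \<le> card V2"
        using finite_V1_V2 V1_Int_V2 by (auto intro!: card_mono)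
      then have c: "2 \<le> card V1" "2 \<le> card V2" using uv by simp_all
      \<comment> \<open>If \<open>V1\<close> has \<open>l + 1\<close> vertices, then
        \<open>V2\<close> has \<open>?N - l + 1\<close>, since both ends of the chord are counted
        twice.\<close>
      have N: "card V1 - 1 + 1 = card V1" "?N - (card V1 - 1) + 1 = card V2"
        using c card_cut by auto
      have "(\<Sum>i\<le>m'. total_weight w V1 i * total_weight w V2 (m' - i)) =
          (\<Sum>i<m. dissection_coeff F (card V1 - 1 + 1) i *
          dissection_coeff F (?N - (card V1 - 1) + 1) (m - 1 - i))"
        unfolding N using less.IH[OF _ finite_V1_V2(1) c(1)] less.IH[OF _ finite_V1_V2(2) c(2)]
        by (intro sum.cong) (auto simp: Suc)
      then show "(\<Sum>i\<le>m'. total_weight w (V \<inter> {u..v}) i *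
          total_weight w (V - {u<..<v}) (m' - i)) = H (card (V \<inter> {u..v}) - 1)"
        unfolding V1_def V2_def H_def .
    qed
    also have "\<dots> = (\<Sum>l = 1..<?N. real (?N - l) * H l)"
      by (rule sum_pairs_card[OF less.prems(1)])
    also have "\<dots> = real m * dissection_coeff F ?N m"
      unfolding H_def by (rule dissection_coeff_marked_chord[OF less.prems(2) F0])
    finally show ?thesis by (simp add: Suc)
  qed
qed

section \<open>From vertex sets back to the polygon with vertices \<open>{..<N}\<close>\<close>

lemma mem_boundary_pair:
  assumes "x < y" "y < N"
  shows "{x, y} \<in># boundary N \<longleftrightarrow> y = Suc x \<or> x = 0 \<and> y = N - 1"
proof -
  have "{x, y} \<in># boundary N \<longleftrightarrow> (\<exists>i<N. {x, y} = {i, Suc i mod N})"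
    by (auto simp: boundary_def)
  also have "\<dots> \<longleftrightarrow> (\<exists>i<N. {x, y} = {i, if Suc i = N then 0 else Suc i})"
    by (intro ex_cong1 conj_cong refl) auto
  also have "\<dots> \<longleftrightarrow> y = Suc x \<or> x = 0 \<and> y = N - 1"
  proof
    assume "\<exists>i<N. {x, y} = {i, if Suc i = N then 0 else Suc i}"
    then show "y = Suc x \<or> x = 0 \<and> y = N - 1" using assms
      by (auto simp: doubleton_eq_iff split: if_splits)
  next
    assume "y = Suc x \<or> x = 0 \<and> y = N - 1"
    then show "\<exists>i<N. {x, y} = {i, if Suc i = N then 0 else Suc i}"
    proof
      assume "y = Suc x"
      then show ?thesis using assms by (intro exI[of _ x]) auto
    next
      assume "x = 0 \<and> y = N - 1"
      then show ?thesis using assms by (intro exI[of _ y]) auto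
    qed
  qed
  finally show ?thesis .
qed

lemma lessThan_sides:
  fixes x y N :: nat
  assumes "x < y" "y < N"
  shows "{..<N} \<inter> {x<..<y} = {} \<longleftrightarrow> y = Suc x" "{..<N} \<subseteq> {x..y} \<longleftrightarrow> x = 0 \<and> y = N - 1"
proof -
  show "{..<N} \<inter> {x<..<y} = {} \<longleftrightarrow> y = Suc x"
  proof
    assume "{..<N} \<inter> {x<..<y} = {}"
    then have "Suc x \<notin> {..<N} \<inter> {x<..<y}" by blast
    then show "y = Suc x" using assms by auto
  qed auto
  show "{..<N} \<subseteq> {x..y} \<longleftrightarrow> x = 0 \<and> y = N - 1"
  proof
    assume "{..<N} \<subseteq> {x..y}"
    then have "0 \<in> {x..y}" "N - 1 \<in> {x..y}" using assms by (auto simp: subset_iff)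
    then show "x = 0 \<and> y = N - 1" using assms by auto
  qed auto
qed

lemma chords_eq_chords_on: "chords N = chords_on {..<N}"
  by (simp add: chords_def chords_on_def)

lemma set_mset_boundary:
  assumes "2 \<le> N"
  shows "set_mset (boundary N) = polygon_sides {..<N}"
proof -
  have "e \<in># boundary N \<longleftrightarrow> e \<in> polygon_sides {..<N}" if e: "e \<in> chords_on {..<N}" for e
  proof -
    obtain x y where "e = {x, y}" "x < y" "x \<in> {..<N}" "y \<in> {..<N}" using e by (rule chords_onE)
    then show ?thesis
      using mem_boundary_pair[of x y N] lessThan_sides[of x y N] by (simp add: polygon_sides_pair)
  qed
  then show ?thesis
    using boundary_subset_chords[OF assms] polygon_sides_subset_chords_on[of "{..<N}"]
    unfolding chords_eq_chords_on by blast
qed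

lemma count_boundary_eq_side_mult:
  assumes "2 \<le> N" "e \<in> chords_on {..<N}"
  shows "count (boundary N) e = side_mult {..<N} e"
proof -
  obtain x y where xy: "e = {x, y}" "x < y" "x \<in> {..<N}" "y \<in> {..<N}"
    using assms(2) by (rule chords_onE)
  then have y: "y < N" by simp
  show ?thesis
  proof (cases "N = 2")
    \<comment> \<open>The 2-gon is the only polygon whose boundary contains a chord twice, so it is
      computed directly.\<close>
    case True
    then have "x = 0" "y = 1" using xy by auto
    moreover have "boundary 2 = {#{0, 1}, {0, 1}#}"
      by (simp add: boundary_def numeral_2_eq_2 lessThan_Suc insert_commute)
    ultimately show ?thesis
      using True lessThan_sides[OF xy(2) y] by (simp add: xy(1) side_mult_pair)
  next
    case False
    then show ?thesis using assms count_boundary[of N e] lessThan_sides[OF xy(2) y]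
        mem_boundary_pair[OF xy(2) y] xy(2)
      by (auto simp: xy(1) side_mult_pair)
  qed
qed

text \<open>Big parts carry the index \<open>0\<close> and digons the index of their copy; sizes at
  least 3 and exactly 2 keep the two families apart.\<close>

lemma prod_parts_eq_weight:
  assumes "2 \<le> N"
  shows "(\<Prod>P\<in>parts N D. w (num_sides P)) = weight w {..<N} D"
proof -
  let ?V = "{..<N}"
  let ?B = "(\<lambda>S. (S, 0::nat)) ` big_parts ?V D"
  let ?D = "SIGMA e : chords_on ?V. {..<count D e + side_mult ?V e - 1}"
  have "parts N D = ?B \<union> ?D"
  proof -
    have "{(S, 0::nat) |S. S \<subseteq> {..<N} \<and> 3 \<le> card S \<and> polygon_sides S \<subseteq> set_mset (D + boundary N) \<and>
        (\<forall>e\<in>#D. e \<subseteq> S \<longrightarrow> e \<in> polygon_sides S)} = ?B"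
      unfolding big_parts_def set_mset_union set_mset_boundary[OF assms] by blast
    moreover have "{(e, i) |e i. e \<in> chords N \<and> Suc i < count (D + boundary N) e} = ?D"
      using count_boundary_eq_side_mult[OF assms] by (auto simp: chords_eq_chords_on)
    ultimately show ?thesis unfolding parts_def by simp
  qed
  moreover have "?B \<inter> ?D = {}" by (auto simp: big_parts_def chords_on_def)
  ultimately have "(\<Prod>P\<in>parts N D. w (num_sides P)) =
      (\<Prod>P\<in>?B. w (num_sides P)) * (\<Prod>P\<in>?D. w (num_sides P))"
    by (simp add: prod.union_disjoint finite_big_parts finite_chords_on)
  moreover have "(\<Prod>P\<in>?B. w (num_sides P)) = (\<Prod>S\<in>big_parts ?V D. w (card S))"
    by (subst prod.reindex) (auto simp: inj_on_def)
  moreover have "(\<Prod>P\<in>?D. w (num_sides P)) = w 2 ^ num_digons ?V D"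
  proof -
    have "(\<Prod>P\<in>?D. w (num_sides P)) = (\<Prod>P\<in>?D. w 2)"
      by (rule prod.cong) (auto simp: chords_on_def)
    then show ?thesis by (simp add: num_digons_def finite_chords_on)
  qed
  ultimately show ?thesis by (simp add: weight_def)
qed

section \<open>Colored parts as weights, and the resulting power series\<close>

definition part_weight :: "nat \<Rightarrow> nat \<Rightarrow> (nat \<Rightarrow> nat) \<Rightarrow> nat \<Rightarrow> real" where
  "part_weight a b c s = (if \<exists>j\<ge>1. s = a * j + b then real (c ((s - b) div a)) else 0)"

text \<open>A part of inadmissible size gets weight \<open>0\<close>, so the sum may run over all
  dissections.\<close>

lemma card_colored_partitions_eq_total_weight:
  assumes "0 \<le> r"
  shows "real (card (colored_partitions a b c r k)) =
      total_weight (part_weight a b c) {..<nat (r + 2)} (k - 1)"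
proof -
  let ?N = "nat (r + 2)" and ?w = "part_weight a b c"
  have N: "2 \<le> ?N" using assms by simp
  have diss: "dissections {..<?N} (k - 1) = {D. dissection ?N (k - 1) D}"
    by (simp add: dissections_def dissection_def chords_eq_chords_on)
  have "real (card (colored_partitions a b c r k)) =
     (\<Sum>D\<in>admissible_dissections a b r k. \<Prod>P\<in>parts ?N D. ?w (num_sides P))"
    unfolding card_colored_partitions of_nat_sum of_nat_prod
    by (intro sum.cong prod.cong refl) (auto simp: admissible_dissections_def part_weight_def)
  also have "\<dots> = (\<Sum>D\<in>dissections {..<?N} (k - 1). \<Prod>P\<in>parts ?N D. ?w (num_sides P))"
  proof (rule sum.mono_neutral_left)
    show "finite (dissections {..<?N} (k - 1))" by (simp add: finite_dissections_on)
    show "admissible_dissections a b r k \<subseteq> dissections {..<?N} (k - 1)"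
      unfolding diss admissible_dissections_def by auto
    show "\<forall>D\<in>dissections {..<?N} (k - 1) - admissible_dissections a b r k.
      (\<Prod>P\<in>parts ?N D. ?w (num_sides P)) = 0"
    proof
      fix D assume "D \<in> dissections {..<?N} (k - 1) - admissible_dissections a b r k"
      then obtain P where "P \<in> parts ?N D" "\<not> (\<exists>j\<ge>1. num_sides P = a * j + b)"
        using assms unfolding diss admissible_dissections_def by blast
      then have "P \<in> parts ?N D" "?w (num_sides P) = 0" by (auto simp: part_weight_def)
      then show "(\<Prod>P\<in>parts ?N D. ?w (num_sides P)) = 0"
        using finite_parts by (meson prod_zero)
    qed
  qed
  also have "\<dots> = total_weight ?w {..<?N} (k - 1)"
    unfolding total_weight_def by (simp add: prod_parts_eq_weight[OF N])
  finally show ?thesis .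
qed

text \<open>An \<open>(a * j + b)\<close>-gon is a node with \<open>a * j + b - 1\<close> children,
  so its number of colors sits at the exponent \<open>(b - 1) + a * j\<close>.\<close>

lemma part_weight_fps:
  fixes c :: "nat \<Rightarrow> nat"
  assumes "1 \<le> a" "1 \<le> b"
  shows "Abs_fps (\<lambda>d. if d = 0 then 0 else part_weight a b c (Suc d)) =
    fps_X ^ (b - 1) * (Abs_fps (\<lambda>j. if j = 0 then 0 else real (c j)) oo fps_X ^ a)"
proof (rule fps_ext)
  fix d
  show "Abs_fps (\<lambda>d. if d = 0 then 0 else part_weight a b c (Suc d)) $ d =
    (fps_X ^ (b - 1) * (Abs_fps (\<lambda>j. if j = 0 then 0 else real (c j)) oo fps_X ^ a)) $ d"
  proof (cases "\<exists>j\<ge>1. Suc d = a * j + b")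
    case True
    then obtain j where j: "1 \<le> j" "Suc d = a * j + b" by blast
    then have d: "d - (b - 1) = a * j" "\<not> d < b - 1" "Suc d - b = a * j" using assms by auto
    have "1 \<le> a * j" using assms(1) j(1) by simp
    then have "d \<noteq> 0" using j(2) assms(2) by linarith
    then show ?thesis using True j(1) d assms
      by (simp add: fps_X_power_mult_nth fps_nth_compose_X_power part_weight_def)
  next
    case False
    \<comment> \<open>With \<open>j \<ge> 1\<close> ruled out, the exponent can only come from
      \<open>j = 0\<close>, where the inner series has coefficient \<open>0\<close>.\<close>
    have "(d - (b - 1)) div a = 0" if "\<not> d < b - 1" "a dvd d - (b - 1)"
    proof (rule ccontr)
      assume "(d - (b - 1)) div a \<noteq> 0"
      moreover have "Suc d = a * ((d - (b - 1)) div a) + b" using that assms by simp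
      ultimately show False using False by (metis One_nat_def Suc_leI gr0I)
    qed
    moreover have "part_weight a b c (Suc d) = 0"
      using False unfolding part_weight_def by (rule if_not_P)
    ultimately show ?thesis using assms
      by (simp add: fps_X_power_mult_nth fps_nth_compose_X_power)
  qed
qed

text \<open>Each of the \<open>k\<close> factors contributes the shift \<open>b - 1\<close>, and
  substituting \<open>fps_X ^ a\<close> moves degree \<open>n\<close> to
  \<open>a * n\<close>.\<close>

lemma part_weight_fps_power_nth:
  fixes c :: "nat \<Rightarrow> nat"
  assumes "1 \<le> a" "1 \<le> b"
  shows "(Abs_fps (\<lambda>d. if d = 0 then 0 else part_weight a b c (Suc d)) ^ k) $ (a * n + (b - 1) *
      k) =
    (Abs_fps (\<lambda>j. if j = 0 then 0 else real (c j)) ^ k) $ n"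
proof -
  have "(fps_X ^ a :: real fps) $ 0 = 0" using assms by simp
  then show ?thesis unfolding part_weight_fps[OF assms] power_mult_distrib power_mult[symmetric]
    using assms by (simp add: fps_compose_power fps_X_power_mult_nth fps_nth_compose_X_power)
qed

theorem theorem2:
  fixes a b n k :: nat and c :: "nat \<Rightarrow> nat"
  assumes "1 \<le> a" and "1 \<le> b" and "1 \<le> n" and "1 \<le> k"
  shows "real (card (colored_partitions a b c (int a * int n + (int b - 2) * int k) k)) =
    1 / real (a * n + (b - 1) * k + 1) * real ((a * n + (b - 1) * k + 1) choose k) *
    (fact k / fact n) * partial_bell n k (\<lambda>j. fact j * real (c j))"
proof -
  define r where "r = int a * int n + (int b - 2) * int k"
  define m where "m = a * n + (b - 1) * k + 1"
  let ?\<Phi> = "Abs_fps (\<lambda>j. if j = 0 then 0 else real (c j))"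
  let ?F = "Abs_fps (\<lambda>d. if d = 0 then 0 else part_weight a b c (Suc d))"
  have bell: "fact k / fact n * partial_bell n k (\<lambda>j. fact j * real (c j)) = (?\<Phi> ^ k) $ n"
    by (rule partial_bell_eq_fps_power_nth)
  obtain b' where "b = Suc b'" using assms(2) by (cases b) auto
  \<comment> \<open>The tree of an \<open>(r + 2)\<close>-gon with \<open>k\<close> parts has
    \<open>r + 1\<close> leaves and \<open>k\<close> inner nodes, so \<open>m\<close> is its number
    of nodes. Writing \<open>b\<close> as \<open>Suc b'\<close> resolves the truncated
    \<open>b - 1\<close>.\<close>
  then have rm: "r + 1 + int k = int m" by (simp add: r_def m_def algebra_simps)
  have "real (card (colored_partitions a b c r k)) =
      1 / real m * real (m choose k) * (?\<Phi> ^ k) $ n"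
  proof (cases "0 \<le> r")
    case True
    let ?N = "nat (r + 2)"
    have N: "2 \<le> ?N" "?N - 1 + k = m" using True rm by auto
    have "real (card (colored_partitions a b c r k)) = dissection_coeff ?F ?N (k - 1)"
      using N card_colored_partitions_eq_total_weight[OF True]
      by (simp add: total_weight_eq_dissection_coeff)
    also have "\<dots> = 1 / real m * real (m choose k) * (?F ^ k) $ (m - 1)"
      using N assms(4) by (simp add: dissection_coeff_def forest_coeff_def)
    also have "(?F ^ k) $ (m - 1) = (?\<Phi> ^ k) $ n"
      using part_weight_fps_power_nth[OF assms(1,2), of c k n] by (simp add: m_def)
    finally show ?thesis .
  next
    case False
    \<comment> \<open>There is no polygon, so the count is \<open>0\<close>. On the other side,
      \<open>a \<ge> 1\<close> and \<open>b - 2 \<ge> -1\<close> give \<open>n < k\<close>, and the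
      \<open>k\<close>-th power of a series without constant term vanishes below degree
      \<open>k\<close>.\<close>
    have "n < k"
    proof -
      have "1 * int n \<le> int a * int n" using assms(1) by (intro mult_right_mono) auto
      moreover have "- 1 * int k \<le> (int b - 2) * int k"
        using assms(2) by (intro mult_right_mono) auto
      ultimately show ?thesis using False unfolding r_def by linarith
    qed
    then have "(?\<Phi> ^ k) $ n = 0" by (simp add: startsby_zero_power_prefix)
    moreover have "colored_partitions a b c r k = {}"
      using False by (simp add: colored_partitions_def admissible_dissections_def)
    ultimately show ?thesis by simp
  qed
  then show ?thesis unfolding r_def m_def bell[symmetric] by (simp only: mult.assoc)
qed

end
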